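(* Let $q$ be a power of a prime $p$ and let $\gamma$ be a generator of $\mathbb{F}_q^*$. Let $d_1, d_2$ be positive integers with $d_1\mid d_2\mid q-1$. For $i=1,2$ let $H_i\subset\mathbb{F}_q$ be an $\mathbb{F}_p(\gamma^{(q-1)/d_i})$-submodule of $\mathbb{F}_q$, with $H_1\subset H_2$, and let $S_i=S(\gamma^{(q-1)/d_i},0,H_i)$, a subgroup of $\mathrm{AGL}(1,\mathbb{F}_q)$. Let $\mu(S_1,S_2)$ denote the value at $(S_1,S_2)$ of the Möbius function of the lattice of subgroups of $\mathrm{AGL}(1,\mathbb{F}_q)$. If $H_1$ is not an $\mathbb{F}_{p(d_2)}$-module, then $\mu(S_1,S_2)=0$. If $H_1$ is an $\mathbb{F}_{p(d_2)}$-module, then $$\mu(S_1,S_2)=\begin{cases}\mu(d_2/d_1)\,\mu_{p(d_2)}(H_2/H_1)&\text{if } d_1\neq 1,\\[2mm] \dfrac{|H_2|}{|H_1|}\,\mu(d_2)\,\mu_{p(d_2)}(H_2/H_1)&\text{if } d_1=1.\end{cases}$$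
   Context: The Möbius function of a locally finite poset $(X,\le)$ is the integer-valued function $\mu$ with $\sum_{x\le z\le y}\mu(x,z)=1$ if $x=y$ and $0$ if $x<y$. Here it is applied to the lattice of subgroups of the finite group $\mathrm{AGL}(1,\mathbb{F}_q)$, ordered by inclusion. $\mathrm{AGL}(1,\mathbb{F}_q)=\left\{\begin{bmatrix} a&b\\0&1\end{bmatrix}: a\in\mathbb{F}_q^*,\ b\in\mathbb{F}_q\right\}$, a subgroup of $\mathrm{GL}(2,\mathbb{F}_q)$. For $a\in\mathbb{F}_q^*$ and an $\mathbb{F}_p(a)$-submodule $H$ of $\mathbb{F}_q$ (i.e. an additive subgroup closed under multiplication by the subfield $\mathbb{F}_p(a)$ of $\mathbb{F}_q$ generated by $a$), $S(a,0,H)$ denotes the subgroup of $\mathrm{AGL}(1,\mathbb{F}_q)$ generated by $\begin{bmatrix} a&0\\0&1\end{bmatrix}$ together with all matrices $\begin{bmatrix}1&h\\0&1\end{bmatrix}$, $h\in H$. For a positive integer $d$ with $p\nmid d$, $p(d)$ denotes the smallest power of $p$ (with positive exponent) that is congruent to $1$ modulo $d$. When $d\mid q-1$, $\mathbb{F}_{p(d)}$ is regarded as a subfield of $\mathbb{F}_q$; it equals $\mathbb{F}_p(\gamma^{(q-1)/d})$. "$H_1$ is an $\mathbb{F}_{p(d_2)}$-module" means that $H_1$ is closed under multiplication by elements of the subfield $\mathbb{F}_{p(d_2)}$ of $\mathbb{F}_q$; in that case $H_2/H_1$ is an $\mathbb{F}_{p(d_2)}$-vector space. For a positive integer $n$,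 $\mu(n)$ (one argument) is the classical number-theoretic Möbius function. For a prime power $r$ and a finite dimensional $\mathbb{F}_r$-vector space $V$, $\mu_r(V)=(-1)^l r^{\binom{l}{2}}$, where $l=\dim_{\mathbb{F}_r}V$.
   Formalization: For d_1=d_2=1 the formal value is μ_{p(d_2)}(H_2/H_1) without the factor |H_2|/|H_1|, since the printed formula fails when H_1≠H_2 (for q=2, H_1=0, H_2=F_2 the value is −1, not −2); the case d_1=1, d_2≠1 is as printed. *)

theory Defs
  imports
    "HOL-Analysis.Analysis"
    "HOL-Number_Theory.Cong"
    "HOL-Computational_Algebra.Squarefree"
    "HOL-Algebra.Generated_Fields"
    "HOL-Algebra.Algebraic_Closure_Type"
    "Jordan_Normal_Form.Missing_VectorSpace"
begin

section \<open>The Moebius function of a locally finite poset\<close>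

text \<open>The values at pairs that are not of the form \<open>x \<le> y\<close> are fixed to be 0, which makes the
  function unique.\<close>

definition is_mobius_function :: "('b, 'm) gorder_scheme \<Rightarrow> ('b \<Rightarrow> 'b \<Rightarrow> int) \<Rightarrow> bool" where
  "is_mobius_function L f \<longleftrightarrow>
     (\<forall>x\<in>carrier L. \<forall>y\<in>carrier L. x \<sqsubseteq>\<^bsub>L\<^esub> y \<longrightarrow>
        (\<Sum>z | z \<in> carrier L \<and> x \<sqsubseteq>\<^bsub>L\<^esub> z \<and> z \<sqsubseteq>\<^bsub>L\<^esub> y. f x z) = (if x = y then 1 else 0)) \<and>
     (\<forall>x y. \<not> (x \<in> carrier L \<and> y \<in> carrier L \<and> x \<sqsubseteq>\<^bsub>L\<^esub> y) \<longrightarrow> f x y = 0)"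

definition mobius :: "('b, 'm) gorder_scheme \<Rightarrow> 'b \<Rightarrow> 'b \<Rightarrow> int" where
  "mobius L = (THE f. is_mobius_function L f)"

definition locally_finite_poset :: "('b, 'm) gorder_scheme \<Rightarrow> bool" where
  "locally_finite_poset L \<longleftrightarrow>
     (\<forall>x\<in>carrier L. \<forall>y\<in>carrier L. finite {z \<in> carrier L. x \<sqsubseteq>\<^bsub>L\<^esub> z \<and> z \<sqsubseteq>\<^bsub>L\<^esub> y})"

lemma is_mobius_function_ex1:
  assumes "partial_order L" "locally_finite_poset L"
  shows "\<exists>!f. is_mobius_function L f"
proof -
  interpret partial_order L by fact
  let ?I = "\<lambda>x y. {z \<in> carrier L. x \<sqsubseteq>\<^bsub>L\<^esub> z \<and> z \<sqsubseteq>\<^bsub>L\<^esub> y}"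
  let ?J = "\<lambda>x y. {z \<in> carrier L. x \<sqsubseteq>\<^bsub>L\<^esub> z \<and> z \<sqsubseteq>\<^bsub>L\<^esub> y \<and> z \<noteq> y}"
  define R where "R = (\<lambda>x. {(z, y). z \<in> carrier L \<and> y \<in> carrier L \<and> x \<in> carrier L \<and>
    x \<sqsubseteq>\<^bsub>L\<^esub> z \<and> z \<sqsubseteq>\<^bsub>L\<^esub> y \<and> z \<noteq> y})"
  have fin: "finite (?I x y)" if "x \<in> carrier L" "y \<in> carrier L" for x y
    using assms(2) that unfolding locally_finite_poset_def by blast
  have anti: "z = y" if "z \<sqsubseteq>\<^bsub>L\<^esub> y" "y \<sqsubseteq>\<^bsub>L\<^esub> z" "z \<in> carrier L" "y \<in> carrier L" for z y
    using le_antisym that by blast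
  have wf: "wf (R x)" for x
  proof (rule wf_subset)
    show "R x \<subseteq> Wellfounded.measure (\<lambda>y. card (?I x y))"
    proof
      fix t assume "t \<in> R x"
      then obtain z y where t: "t = (z, y)" and c: "z \<in> carrier L" "y \<in> carrier L" "x \<in> carrier L"
        and o: "x \<sqsubseteq>\<^bsub>L\<^esub> z" "z \<sqsubseteq>\<^bsub>L\<^esub> y" "z \<noteq> y" unfolding R_def by auto
      have "?I x z \<subseteq> ?I x y" using c o le_trans by blast
      moreover have "y \<in> ?I x y" using c o le_trans by blast
      moreover have "y \<notin> ?I x z" using c o anti by blast
      ultimately have "?I x z \<subset> ?I x y" by blast
      then have "card (?I x z) < card (?I x y)" by (rule psubset_card_mono[OF fin[OF c(3,2)]])
      then show "t \<in> Wellfounded.measure (\<lambda>y. card (?I x y))" by (simp add: t)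
    qed
  qed simp
  have split: "(\<Sum>z\<in>?I x y. f z) = f y + (\<Sum>z\<in>?J x y. f z)"
    if "x \<in> carrier L" "y \<in> carrier L" "x \<sqsubseteq>\<^bsub>L\<^esub> y" for x y and f :: "'a \<Rightarrow> int"
  proof -
    have "?I x y = insert y (?J x y)" using that by auto
    moreover have "finite (?J x y)" using fin[OF that(1,2)] by (rule rev_finite_subset) auto
    ultimately show ?thesis by simp
  qed
  define F where "F = (\<lambda>x (g :: 'a \<Rightarrow> int) y. if x \<in> carrier L \<and> y \<in> carrier L \<and> x \<sqsubseteq>\<^bsub>L\<^esub> y
     then (if x = y then 1 else 0) - (\<Sum>z\<in>?J x y. g z) else 0)"
  define f where "f = (\<lambda>x. wfrec (R x) (F x))"
  have f_eq: "f x y = F x (f x) y" for x y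
  proof -
    have "f x y = F x (cut (f x) (R x) y) y" unfolding f_def by (rule wfrec[OF wf])
    also have "\<dots> = F x (f x) y"
      unfolding F_def by (auto simp: cut_def R_def intro!: sum.cong)
    finally show ?thesis .
  qed
  have "is_mobius_function L f"
    unfolding is_mobius_function_def
  proof (intro conjI ballI allI impI)
    fix x y assume a: "x \<in> carrier L" "y \<in> carrier L" "x \<sqsubseteq>\<^bsub>L\<^esub> y"
    show "(\<Sum>z\<in>?I x y. f x z) = (if x = y then 1 else 0)"
      using split[OF a, of "f x"] f_eq[of x y] a by (simp add: F_def)
  next
    fix x y assume "\<not> (x \<in> carrier L \<and> y \<in> carrier L \<and> x \<sqsubseteq>\<^bsub>L\<^esub> y)"
    then show "f x y = 0" using f_eq[of x y] by (auto simp: F_def)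
  qed
  moreover have "g = f" if g: "is_mobius_function L g" for g
  proof (intro ext)
    fix x y
    show "g x y = f x y"
    proof (induction y rule: wf_induct_rule[OF wf[of x]])
      case (1 y)
      show ?case
      proof (cases "x \<in> carrier L \<and> y \<in> carrier L \<and> x \<sqsubseteq>\<^bsub>L\<^esub> y")
        case True
        have "(\<Sum>z\<in>?J x y. g x z) = (\<Sum>z\<in>?J x y. f x z)"
          by (rule sum.cong) (use 1 True in \<open>auto simp: R_def\<close>)
        moreover have "(\<Sum>z\<in>?I x y. g x z) = (\<Sum>z\<in>?I x y. f x z)"
          using g \<open>is_mobius_function L f\<close> True unfolding is_mobius_function_def by simp
        ultimately show ?thesis using split True by simp
      next
        case False
        then show ?thesis using g \<open>is_mobius_function L f\<close> unfolding is_mobius_function_def by metis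
      qed
    qed
  qed
  ultimately show ?thesis by blast
qed

definition subgroup_lattice :: "('b, 'm) monoid_scheme \<Rightarrow> 'b set gorder" where
  "subgroup_lattice G = \<lparr>carrier = {H. subgroup H G}, eq = (=), le = (\<subseteq>)\<rparr>"


section \<open>The affine group of a field\<close>

definition GL2 :: "('a::field ^ 2 ^ 2) monoid" where
  "GL2 = \<lparr>carrier = {A. invertible A}, monoid.mult = (**), one = mat 1\<rparr>"

definition affine_mat :: "'a::field \<Rightarrow> 'a \<Rightarrow> 'a ^ 2 ^ 2" where
  "affine_mat a b = vector [vector [a, b], vector [0, 1]]"

definition AGL1 :: "('a::field ^ 2 ^ 2) monoid" where
  "AGL1 = GL2\<lparr>carrier := {affine_mat a b | a b. a \<noteq> 0}\<rparr>"

lemma affine_mat_mult: "affine_mat a b ** affine_mat c d = affine_mat (a * c) (a * d + b)"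
  by (simp add: affine_mat_def vec_eq_iff forall_2 matrix_matrix_mult_def sum_2)

lemma affine_mat_one: "affine_mat 1 0 = mat 1"
  by (simp add: affine_mat_def vec_eq_iff forall_2 mat_def)

lemma affine_mat_eq_iff: "affine_mat a b = affine_mat c d \<longleftrightarrow> a = c \<and> b = d"
  by (auto simp: affine_mat_def vec_eq_iff forall_2)

lemma invertible_affine_mat:
  assumes "a \<noteq> 0" shows "invertible (affine_mat a b)"
proof -
  have "affine_mat a b ** affine_mat (inverse a) (- inverse a * b) = mat 1"
    "affine_mat (inverse a) (- inverse a * b) ** affine_mat a b = mat 1"
    using assms by (simp_all add: affine_mat_mult affine_mat_one[symmetric] affine_mat_eq_iff field_simps)
  then show ?thesis unfolding invertible_def by blast
qed

lemma group_GL2: "group (GL2 :: ('a::field ^ 2 ^ 2) monoid)"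
proof (rule groupI)
  fix A :: "'a^2^2" assume "A \<in> carrier GL2"
  then show "\<exists>B\<in>carrier GL2. B \<otimes>\<^bsub>GL2\<^esub> A = \<one>\<^bsub>GL2\<^esub>"
    by (auto simp: GL2_def invertible_def)
next
  show "\<one>\<^bsub>GL2\<^esub> \<in> carrier (GL2 :: ('a ^ 2 ^ 2) monoid)"
    by (auto simp: GL2_def invertible_def intro!: exI[of _ "mat 1"])
qed (auto simp: GL2_def invertible_mult matrix_mul_assoc)

lemma carrier_AGL1: "carrier AGL1 = {affine_mat a b | a b. a \<noteq> 0}"
  by (simp add: AGL1_def)

lemma subgroup_AGL1: "subgroup (carrier AGL1) (GL2 :: ('a::field ^ 2 ^ 2) monoid)"
proof (rule group.subgroupI[OF group_GL2])
  show "carrier AGL1 \<subseteq> carrier (GL2 :: ('a ^ 2 ^ 2) monoid)"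
    by (auto simp: carrier_AGL1 GL2_def invertible_affine_mat)
  have "affine_mat 1 0 \<in> carrier (AGL1 :: ('a ^ 2 ^ 2) monoid)"
    unfolding carrier_AGL1 using one_neq_zero[where 'a = 'a] by blast
  then show "carrier AGL1 \<noteq> ({} :: ('a ^ 2 ^ 2) set)" by blast
  fix A B :: "'a^2^2" assume A: "A \<in> carrier AGL1" and B: "B \<in> carrier AGL1"
  from A obtain a b where ab: "A = affine_mat a b" "a \<noteq> 0" unfolding carrier_AGL1 by blast
  from B obtain c d where cd: "B = affine_mat c d" "c \<noteq> 0" unfolding carrier_AGL1 by blast
  have "A \<otimes>\<^bsub>GL2\<^esub> B = affine_mat (a * c) (a * d + b)" "a * c \<noteq> 0"
    using ab cd by (simp_all add: GL2_def affine_mat_mult)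
  then show "A \<otimes>\<^bsub>GL2\<^esub> B \<in> carrier AGL1" unfolding carrier_AGL1 by blast
  have "inv\<^bsub>GL2\<^esub> A = affine_mat (inverse a) (- inverse a * b)"
  proof (rule group.inv_equality[OF group_GL2])
    show "affine_mat (inverse a) (- inverse a * b) \<otimes>\<^bsub>GL2\<^esub> A = \<one>\<^bsub>GL2\<^esub>"
      using ab by (simp add: GL2_def affine_mat_mult affine_mat_one[symmetric] affine_mat_eq_iff)
  qed (use ab in \<open>simp_all add: GL2_def invertible_affine_mat\<close>)
  moreover have "inverse a \<noteq> 0" using ab by simp
  ultimately show "inv\<^bsub>GL2\<^esub> A \<in> carrier AGL1" unfolding carrier_AGL1 by blast
qed

lemma group_AGL1: "group (AGL1 :: ('a::field ^ 2 ^ 2) monoid)"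
  using group.subgroup_imp_group[OF group_GL2 subgroup_AGL1] by (simp add: AGL1_def)

lemma is_mobius_function_AGL1:
  "is_mobius_function (subgroup_lattice AGL1)
     (mobius (subgroup_lattice (AGL1 :: ('a::{field, finite} ^ 2 ^ 2) monoid)))"
  unfolding mobius_def
proof (rule theI'[OF is_mobius_function_ex1])
  show "partial_order (subgroup_lattice (AGL1 :: ('a ^ 2 ^ 2) monoid))"
    unfolding subgroup_lattice_def by (rule group.subgroups_partial_order[OF group_AGL1])
  show "locally_finite_poset (subgroup_lattice (AGL1 :: ('a ^ 2 ^ 2) monoid))"
    by (simp add: locally_finite_poset_def)
qed

text \<open>\<open>S_subgroup a H\<close> is the subgroup \<open>S(a, 0, H)\<close>.\<close>

definition S_subgroup :: "'a::field \<Rightarrow> 'a set \<Rightarrow> ('a ^ 2 ^ 2) set" where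
  "S_subgroup a H = generate AGL1 ({affine_mat a 0} \<union> affine_mat 1 ` H)"


section \<open>Subfields, submodules and quotient spaces\<close>

text \<open>The field as a HOL-Algebra record. For a subset \<open>K\<close> of it, \<open>subalgebra K H \<F>\<close> says that \<open>H\<close> is an
  additive subgroup closed under multiplication by elements of \<open>K\<close>; \<open>generate_field \<F> {a}\<close> contains
  the prime field and is thus the subfield generated by \<open>a\<close> over it.\<close>

abbreviation field_rec :: "'a::field ring" (\<open>\<F>\<close>) where
  "\<F> \<equiv> ring_of_type_algebra"

definition subfield_of_order :: "nat \<Rightarrow> 'a::field set" where
  "subfield_of_order r = (THE K. subfield K \<F> \<and> card K = r)"

definition p_of :: "nat \<Rightarrow> nat \<Rightarrow> nat" where
  "p_of p d = (LEAST r. \<exists>k>0. r = p ^ k \<and> [r = 1] (mod d))"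

text \<open>The space of cosets of \<open>U\<close> in \<open>W\<close>. The multiplicative components, present because module
  records extend ring records, play no role. Adding \<open>U\<close> in the scalar multiplication matters for
  the scalar 0 only.\<close>

definition quotient_space :: "('a, 'm) ring_scheme \<Rightarrow> 'a set \<Rightarrow> 'a set \<Rightarrow> ('a, 'a set) module" where
  "quotient_space R W U =
     \<lparr>carrier = a_rcosets\<^bsub>R\<lparr>carrier := W\<rparr>\<^esub> U, monoid.mult = undefined, one = undefined,
      zero = U, add = (<+>\<^bsub>R\<^esub>), smult = (\<lambda>k C. ((\<lambda>x. k \<otimes>\<^bsub>R\<^esub> x) ` C) <+>\<^bsub>R\<^esub> U)\<rparr>"


section \<open>The Moebius functions of numbers and of vector spaces\<close>

definition mobius_nat :: "nat \<Rightarrow> int" where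
  "mobius_nat n = (if squarefree n then (-1) ^ card (prime_factors n) else 0)"

definition mobius_space :: "('k, 'm) ring_scheme \<Rightarrow> ('k, 'v, 'n) module_scheme \<Rightarrow> int" where
  "mobius_space K V =
     (let r = order K; l = vectorspace.dim K V in (-1) ^ l * int r ^ (l choose 2))"

text \<open>With \<open>V = H\<^sub>2/H\<^sub>1\<close>, the factor \<open>|H\<^sub>2|/|H\<^sub>1|\<close> that occurs in the Moebius function of the interval
  from \<open>S(1,0,H\<^sub>1)\<close> to \<open>S(a,0,H\<^sub>2)\<close>, where \<open>a\<close> has order \<open>d\<^sub>2\<close>, is the number of complements of the
  translation subgroup \<open>V\<close> in \<open>V \<rtimes> \<langle>a\<rangle>\<close>. For \<open>d\<^sub>2 = 1\<close> the only complement is trivial, the interval is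
  the lattice of subspaces of \<open>V\<close> over the prime field, and the factor has to be dropped: already
  for \<open>H\<^sub>1 = 0\<close> and \<open>H\<^sub>2\<close> the field with two elements the value is -1, not -2. Hence the case
  distinction on \<open>d\<^sub>1\<close> has to treat \<open>d\<^sub>1 = d\<^sub>2 = 1\<close> separately.\<close>

end

theory Submission
  imports Defs "HOL-Number_Theory.Residues"
begin

text \<open>
  A subgroup \<open>S\<close> of the affine group has a group of linear parts, which is the group of all \<open>d\<close>-th roots
  of unity for some \<open>d\<close> (\<open>mult_closed_eq_unity_roots\<close>), and an additive group \<open>H\<close> of translations, which is
  stable under these roots. If \<open>d \<noteq> 1\<close>, then \<open>S\<close> consists of all maps with linear part a \<open>d\<close>-th root of unity
  that fix a point \<open>c\<close> modulo \<open>H\<close> (\<open>affine_subgroup.eq_fixing_subgroup\<close>); the point \<open>c\<close>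
  is determined up to \<open>H\<close> (\<open>fixing_subgroup_subset_imp_point\<close>).
  Thus above \<open>S\<^sub>1\<close> with \<open>d\<^sub>1 \<noteq> 1\<close> only \<open>c = 0\<close> is possible and a subgroup is a pair \<open>(d, H)\<close>, whereas above a
  group of translations each pair \<open>(d, H)\<close> with \<open>d \<noteq> 1\<close> occurs \<open>|W|/|H|\<close> times inside a subgroup with
  translations \<open>W\<close> (\<open>card_subgroups_with_parts\<close>).

  The Moebius function with lower argument \<open>S\<^sub>1\<close> is the only function satisfying the defining recurrence,
  so it is enough to verify that the claimed values sum to 0 over every interval from \<open>S\<^sub>1\<close> to some \<open>T \<noteq> S\<^sub>1\<close>
  (\<open>sum_interval_value\<close>). For fixed \<open>d\<close>, the factor \<open>|H|/|H\<^sub>1|\<close> cancels the dependence of the number of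
  subgroups on \<open>H\<close>. What remains is the sum of \<open>(-1)\<^sup>l r\<^bsup>l(l-1)/2\<^esup>\<close>, with \<open>l\<close> the dimension, over all subspaces
  of a vector space over the field generated by the \<open>d\<close>-th roots of unity, where \<open>r\<close> is the order of this
  field. This sum vanishes unless the space is zero (\<open>sum_subspace_mobius\<close>, by comparison with a hyperplane). If it is zero, summing \<open>\<mu>(d/d\<^sub>1)\<close> over \<open>d\<close>
  gives the result (\<open>sum_mobius_nat\<close>). The orders \<open>d\<close> for which \<open>H\<^sub>1\<close> is not a module contribute nothing.
  They cause no defect in the recurrence: if \<open>T\<close> has the translations \<open>H\<^sub>1\<close>, then \<open>H\<^sub>1\<close> is a module for all
  \<open>d\<close> that occur below \<open>T\<close>.

  The field with \<open>p(d)\<close> elements is the set of fixed points of the power map to the exponent \<open>p(d)\<close>. It is the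
  least subfield containing the \<open>d\<close>-th roots of unity, because the order of such a subfield is a power of \<open>p\<close>
  and is 1 modulo \<open>d\<close> (\<open>p_of_le_card_subfield\<close>).
\<close>

section \<open>Subgroups and subfields of a finite field\<close>

definition is_add_subgroup :: "'a::ab_group_add set \<Rightarrow> bool" where
  "is_add_subgroup H \<longleftrightarrow> 0 \<in> H \<and> (\<forall>x\<in>H. \<forall>y\<in>H. x - y \<in> H)"

definition is_subfield :: "'a::field set \<Rightarrow> bool" where
  "is_subfield K \<longleftrightarrow> is_add_subgroup K \<and> 1 \<in> K \<and> (\<forall>x\<in>K. \<forall>y\<in>K. x * y \<in> K) \<and> (\<forall>x\<in>K. inverse x \<in> K)"

text \<open>For a subgroup of a finite field this set is a subfield, the largest one over which the subgroup
  is a vector space.\<close>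

definition multipliers :: "'a::ring set \<Rightarrow> 'a set" where
  "multipliers H = {k. \<forall>h\<in>H. k * h \<in> H}"

definition unity_roots :: "nat \<Rightarrow> 'a::field set" where
  "unity_roots d = {x. x ^ d = 1}"

lemma is_add_subgroup_zero: "is_add_subgroup H \<Longrightarrow> 0 \<in> H"
  by (simp add: is_add_subgroup_def)

lemma is_add_subgroup_diff: "is_add_subgroup H \<Longrightarrow> x \<in> H \<Longrightarrow> y \<in> H \<Longrightarrow> x - y \<in> H"
  by (simp add: is_add_subgroup_def)

lemma is_add_subgroup_minus: "is_add_subgroup H \<Longrightarrow> x \<in> H \<Longrightarrow> - x \<in> H"
  using is_add_subgroup_diff[of H 0 x] by (simp add: is_add_subgroup_zero)

lemma is_add_subgroup_add: "is_add_subgroup H \<Longrightarrow> x \<in> H \<Longrightarrow> y \<in> H \<Longrightarrow> x + y \<in> H"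
  using is_add_subgroup_diff[of H x "- y"] by (simp add: is_add_subgroup_minus)

lemma is_add_subgroup_Int: "is_add_subgroup H \<Longrightarrow> is_add_subgroup H' \<Longrightarrow> is_add_subgroup (H \<inter> H')"
  by (simp add: is_add_subgroup_def)

lemma is_subfield_Int: "is_subfield K \<Longrightarrow> is_subfield K' \<Longrightarrow> is_subfield (K \<inter> K')"
  by (simp add: is_subfield_def is_add_subgroup_Int)

lemma multipliersD: "k \<in> multipliers H \<Longrightarrow> h \<in> H \<Longrightarrow> k * h \<in> H"
  by (simp add: multipliers_def)

lemma is_add_subgroup_group:
  assumes "is_add_subgroup (H :: 'a::ab_group_add set)"
  shows "group \<lparr>carrier = H, monoid.mult = (+), one = (0::'a)\<rparr>"
proof (rule groupI)
  fix x assume "x \<in> carrier \<lparr>carrier = H, monoid.mult = (+), one = (0::'a)\<rparr>"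
  then show "\<exists>y\<in>carrier \<lparr>carrier = H, monoid.mult = (+), one = (0::'a)\<rparr>.
      y \<otimes>\<^bsub>\<lparr>carrier = H, monoid.mult = (+), one = (0::'a)\<rparr>\<^esub> x = \<one>\<^bsub>\<lparr>carrier = H, monoid.mult = (+), one = (0::'a)\<rparr>\<^esub>"
    by (auto intro!: bexI[of _ "- x"] simp: is_add_subgroup_minus[OF assms])
qed (auto simp: is_add_subgroup_zero[OF assms] is_add_subgroup_add[OF assms] add.assoc)

lemma is_add_subgroup_card_dvd:
  fixes U W :: "'a::ab_group_add set"
  assumes "is_add_subgroup U" "is_add_subgroup W" "U \<subseteq> W" "finite W"
  shows "card U dvd card W"
proof -
  let ?G = "\<lparr>carrier = W, monoid.mult = (+), one = (0::'a)\<rparr>"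
  interpret group ?G by (rule is_add_subgroup_group) fact
  have inv: "inv\<^bsub>?G\<^esub> x = - x" if "x \<in> W" for x
    using that by (intro inv_equality) (auto simp: is_add_subgroup_minus[OF assms(2)])
  have "subgroup U ?G"
    using assms(1,3) by (intro subgroupI)
      (auto simp: inv subsetD is_add_subgroup_minus is_add_subgroup_add dest: is_add_subgroup_zero)
  from lagrange_finite[OF _ this] assms(4) show ?thesis
    by (simp add: order_def) (metis dvd_triv_right)
qed

lemma mult_closed_group:
  fixes B :: "'a::field set"
  assumes "finite B" "1 \<in> B" "0 \<notin> B" and mult: "\<And>x y. x \<in> B \<Longrightarrow> y \<in> B \<Longrightarrow> x * y \<in> B"
  shows "group \<lparr>carrier = B, monoid.mult = (*), one = (1::'a)\<rparr>"
proof (rule groupI)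
  fix x assume "x \<in> carrier \<lparr>carrier = B, monoid.mult = (*), one = (1::'a)\<rparr>"
  then have x: "x \<in> B" by simp
  have "inj_on (\<lambda>y. y * x) B" using x assms(3) by (auto simp: inj_on_def)
  moreover have "(\<lambda>y. y * x) ` B \<subseteq> B" using x mult by auto
  ultimately have "(\<lambda>y. y * x) ` B = B" using assms(1) by (simp add: endo_inj_surj)
  then have "1 \<in> (\<lambda>y. y * x) ` B" using assms(2) by simp
  then show "\<exists>y\<in>carrier \<lparr>carrier = B, monoid.mult = (*), one = (1::'a)\<rparr>.
      y \<otimes>\<^bsub>\<lparr>carrier = B, monoid.mult = (*), one = (1::'a)\<rparr>\<^esub> x = \<one>\<^bsub>\<lparr>carrier = B, monoid.mult = (*), one = (1::'a)\<rparr>\<^esub>"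
    by auto
qed (use assms in \<open>auto simp: mult.assoc\<close>)

lemma mult_closed_card_dvd:
  fixes B C :: "'a::field set"
  assumes "finite C" "0 \<notin> C" and C: "\<And>x y. x \<in> C \<Longrightarrow> y \<in> C \<Longrightarrow> x * y \<in> C"
    and B: "1 \<in> B" "\<And>x y. x \<in> B \<Longrightarrow> y \<in> B \<Longrightarrow> x * y \<in> B" and "B \<subseteq> C"
  shows "card B dvd card C"
proof -
  let ?G = "\<lparr>carrier = C, monoid.mult = (*), one = (1::'a)\<rparr>"
  interpret group ?G by (rule mult_closed_group) (use assms in auto)
  have finB: "finite B" using assms(1,6) by (rule rev_finite_subset)
  interpret B: group "\<lparr>carrier = B, monoid.mult = (*), one = (1::'a)\<rparr>"
    by (rule mult_closed_group) (use assms finB in auto)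
  have "subgroup B ?G"
    by (rule group.group_incl_imp_subgroup) (use assms(6) B.group_axioms is_group in \<open>auto\<close>)
  from lagrange_finite[OF _ this] assms(1) show ?thesis
    by (simp add: order_def) (metis dvd_triv_right)
qed

lemma mult_closed_power_card:
  fixes B :: "'a::field set"
  assumes "finite B" "0 \<notin> B" and mult: "\<And>x y. x \<in> B \<Longrightarrow> y \<in> B \<Longrightarrow> x * y \<in> B" and x: "x \<in> B"
  shows "x ^ card B = 1"
proof -
  have inj: "inj_on (\<lambda>y. x * y) B" using x assms(2) by (auto simp: inj_on_def)
  moreover have "(\<lambda>y. x * y) ` B \<subseteq> B" using x mult by auto
  ultimately have "(\<lambda>y. x * y) ` B = B" using assms(1) by (simp add: endo_inj_surj)
  then have "\<Prod>B = (\<Prod>y\<in>B. x * y)" using prod.reindex[OF inj, of "\<lambda>y. y"] by simp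
  also have "\<dots> = x ^ card B * \<Prod>B" by (simp add: prod.distrib)
  finally show ?thesis using assms(1,2) by simp
qed

lemma card_power_eq_le:
  fixes c :: "'a::field"
  assumes "m > 0"
  shows "card {x. x ^ m = c} \<le> m"
proof -
  let ?P = "Polynomial.monom 1 m - [:c:]"
  have d: "Polynomial.degree ?P \<le> m" by (rule degree_diff_le) (simp_all add: Polynomial.degree_monom_le)
  have "poly.coeff ?P m = 1" using assms by (cases m) simp_all
  then have nz: "?P \<noteq> 0" by (metis coeff_0 zero_neq_one)
  have "{x. x ^ m = c} = {x. poly ?P x = 0}" by (auto simp: Polynomial.poly_monom)
  then show ?thesis using card_poly_roots_bound[OF nz] d by simp
qed

text \<open>The power map to the exponent \<open>(q-1)/d\<close> sends the multiplicative group into the \<open>d\<close>-th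
  roots of unity and has fibres of at most \<open>(q-1)/d\<close> elements, so that it leaves no room for fewer
  than \<open>d\<close> values.\<close>

lemma power_image_unity_roots:
  fixes d :: nat
  assumes d: "d dvd CARD('a::{field,finite}) - 1"
  shows "(\<lambda>x. x ^ ((CARD('a) - 1) div d)) ` (- {0 :: 'a}) = unity_roots d"
    and "card (unity_roots d :: 'a set) = d"
proof -
  define N where "N = CARD('a) - 1"
  define m where "m = N div d"
  have "card {0, 1 :: 'a} \<le> CARD('a)" by (rule card_mono) auto
  then have N: "N > 0" unfolding N_def by simp
  have md: "m * d = N" "m > 0" "d > 0"
    using N dvd_div_mult_self[OF d] unfolding m_def N_def by (metis, metis mult_0 gr0I, metis mult_0_right gr0I)
  let ?f = "\<lambda>x :: 'a. x ^ m"
  have cN: "card (- {0 :: 'a}) = N" by (simp add: N_def Compl_eq_Diff_UNIV)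
  have "x ^ N = 1" if "x \<noteq> 0" for x :: 'a
    using mult_closed_power_card[of "- {0 :: 'a}" x] that cN by simp
  then have sub: "?f ` (- {0}) \<subseteq> unity_roots d"
    by (auto simp: unity_roots_def md(1) simp flip: power_mult)
  have "N = (\<Sum>c\<in>?f ` (- {0}). card {x \<in> - {0}. ?f x = c})"
    using sum.image_gen[of "- {0}" "\<lambda>_. 1 :: nat" ?f] cN by simp
  also have "\<dots> \<le> (\<Sum>c\<in>?f ` (- {0}). m)"
    by (intro sum_mono order.trans[OF card_mono card_power_eq_le[OF md(2)]]) auto
  also have "\<dots> = card (?f ` (- {0})) * m" by simp
  finally have "d \<le> card (?f ` (- {0}))" using md by (simp add: mult.commute flip: md(1))
  moreover have "card (?f ` (- {0})) \<le> card (unity_roots d :: 'a set)" by (rule card_mono[OF _ sub]) simp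
  moreover have "card (unity_roots d :: 'a set) \<le> d"
    unfolding unity_roots_def by (rule card_power_eq_le) fact
  ultimately have c: "card (?f ` (- {0})) = card (unity_roots d :: 'a set)" "card (unity_roots d :: 'a set) = d"
    by linarith+
  show "card (unity_roots d :: 'a set) = d" by fact
  have "?f ` (- {0}) = unity_roots d" by (rule card_subset_eq[OF _ sub c(1)]) simp
  then show "(\<lambda>x. x ^ ((CARD('a) - 1) div d)) ` (- {0 :: 'a}) = unity_roots d"
    by (simp add: m_def N_def)
qed

lemma unity_roots_mult: "x \<in> unity_roots d \<Longrightarrow> y \<in> unity_roots d \<Longrightarrow> x * y \<in> unity_roots d"
  by (simp add: unity_roots_def power_mult_distrib)

lemma unity_roots_mono: "d dvd e \<Longrightarrow> unity_roots d \<subseteq> unity_roots e"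
  by (auto simp: unity_roots_def power_mult elim!: dvdE)

lemma unity_roots_zero: "d > 0 \<Longrightarrow> 0 \<notin> unity_roots d"
  by (simp add: unity_roots_def power_0_left)

lemma unity_roots_one: "1 \<in> unity_roots d"
  by (simp add: unity_roots_def)

lemma unity_roots_1 [simp]: "unity_roots (Suc 0) = {1}"
  by (auto simp: unity_roots_def)

text \<open>All elements of a multiplicative group of order \<open>d\<close> are roots of \<open>X\<^sup>d - 1\<close>, which has at most \<open>d\<close>
  roots. So the group is determined by its order.\<close>

lemma mult_closed_eq_unity_roots:
  fixes B :: "'a::{field,finite} set"
  assumes "1 \<in> B" "0 \<notin> B" and mult: "\<And>x y. x \<in> B \<Longrightarrow> y \<in> B \<Longrightarrow> x * y \<in> B"
  shows "B = unity_roots (card B)" and "card B dvd CARD('a) - 1"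
proof -
  have sub: "B \<subseteq> unity_roots (card B)"
    using mult_closed_power_card[of B] assms by (auto simp: unity_roots_def)
  have "card B > 0" using assms(1) by (auto simp: card_gt_0_iff)
  then have "card (unity_roots (card B) :: 'a set) \<le> card B"
    unfolding unity_roots_def by (rule card_power_eq_le)
  with card_mono[OF _ sub] have "card B = card (unity_roots (card B) :: 'a set)" by simp
  then show "B = unity_roots (card B)" using card_subset_eq[OF _ sub] by simp
  have "card B dvd card (- {0 :: 'a})"
    by (rule mult_closed_card_dvd) (use assms in auto)
  then show "card B dvd CARD('a) - 1" by (simp add: Compl_eq_Diff_UNIV)
qed

text \<open>A nonzero multiplier permutes the finite set \<open>H\<close>, and so does its inverse.\<close>

lemma multipliers_subfield:
  fixes H :: "'a::{field,finite} set"
  assumes H: "is_add_subgroup H"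
  shows "is_subfield (multipliers H)"
  unfolding is_subfield_def
proof (intro conjI ballI)
  show "is_add_subgroup (multipliers H)"
    unfolding is_add_subgroup_def multipliers_def
    by (auto simp: left_diff_distrib is_add_subgroup_zero[OF H] is_add_subgroup_diff[OF H])
  show "1 \<in> multipliers H" by (simp add: multipliers_def)
  show "x * y \<in> multipliers H" if "x \<in> multipliers H" "y \<in> multipliers H" for x y
    using that by (auto simp: multipliers_def mult.assoc)
  show "inverse x \<in> multipliers H" if x: "x \<in> multipliers H" for x
  proof (cases "x = 0")
    case False
    have "inj_on (\<lambda>h. x * h) H" using False by (auto simp: inj_on_def)
    moreover have "(\<lambda>h. x * h) ` H \<subseteq> H" using x by (auto simp: multipliers_def)
    ultimately have eq: "(\<lambda>h. x * h) ` H = H" by (simp add: endo_inj_surj)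
    show ?thesis unfolding multipliers_def
    proof (intro CollectI ballI)
      fix h assume "h \<in> H"
      then obtain h' where "h' \<in> H" "h = x * h'" using eq by blast
      then show "inverse x * h \<in> H" using False by (simp flip: mult.assoc)
    qed
  qed (use x in simp)
qed

section \<open>The subfield generated by the roots of unity\<close>

definition frobenius_fixed :: "nat \<Rightarrow> 'a::field set" where
  "frobenius_fixed r = {x. x ^ r = x}"

lemma freshmans_dream:
  fixes x y :: "'a::field"
  assumes "Factorial_Ring.prime CHAR('a)"
  shows "(x + y) ^ (CHAR('a) ^ k) = x ^ (CHAR('a) ^ k) + y ^ (CHAR('a) ^ k)"
proof (induction k)
  case (Suc k)
  define p where "p = CHAR('a)"
  have p0: "p > 0" using assms by (simp add: p_def prime_gt_0_nat)
  have *: "(a + b) ^ p = a ^ p + b ^ p" for a b :: 'a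
  proof -
    have z: "of_nat (p choose i) = (0 :: 'a)" if "i \<in> {..p} - {0, p}" for i
      unfolding of_nat_eq_0_iff_char_dvd p_def[symmetric]
      by (rule dvd_choose_prime) (use that assms in \<open>auto simp: p_def\<close>)
    have "(a + b) ^ p = (\<Sum>i\<le>p. of_nat (p choose i) * a ^ i * b ^ (p - i))"
      by (rule binomial_ring)
    also have "\<dots> = (\<Sum>i\<in>{0, p}. of_nat (p choose i) * a ^ i * b ^ (p - i))"
      by (rule sum.mono_neutral_right) (use z in auto)
    also have "\<dots> = a ^ p + b ^ p" using p0 by simp
    finally show ?thesis .
  qed
  have "(x + y) ^ (p ^ Suc k) = ((x + y) ^ (p ^ k)) ^ p" by (simp add: mult.commute flip: power_mult)
  also have "\<dots> = (x ^ (p ^ k)) ^ p + (y ^ (p ^ k)) ^ p" using Suc by (simp add: p_def[symmetric] *)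
  finally show ?case by (simp add: mult.commute flip: power_mult p_def)
qed simp

lemma frobenius_fixed_subfield:
  assumes "Factorial_Ring.prime CHAR('a)"
  shows "is_subfield (frobenius_fixed (CHAR('a) ^ k) :: 'a::field set)"
proof -
  let ?r = "CHAR('a) ^ k"
  have r: "?r > 0" using assms by (simp add: prime_gt_0_nat)
  have "x - y \<in> frobenius_fixed ?r" if "x \<in> frobenius_fixed ?r" "y \<in> frobenius_fixed ?r" for x y :: 'a
    using freshmans_dream[OF assms, of "x - y" y k] that by (simp add: frobenius_fixed_def algebra_simps)
  then show ?thesis
    using r by (auto simp: is_subfield_def is_add_subgroup_def frobenius_fixed_def power_mult_distrib power_inverse)
qed

lemma card_power_eq_self_le:
  assumes "r > 1"
  shows "card {x :: 'a::field. x ^ r = x} \<le> r"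
proof -
  let ?P = "Polynomial.monom 1 r - [:0, 1:] :: 'a poly"
  have d: "Polynomial.degree ?P \<le> r"
    by (rule degree_diff_le) (use assms in \<open>simp_all add: Polynomial.degree_monom_le\<close>)
  have "poly.coeff ?P r = 1" using assms by (cases r; cases "r - 1") (simp_all add: coeff_pCons)
  then have nz: "?P \<noteq> 0" by (metis coeff_0 zero_neq_one)
  have "{x :: 'a. x ^ r = x} = {x. poly ?P x = 0}" by (auto simp: Polynomial.poly_monom)
  then show ?thesis using card_poly_roots_bound[OF nz] d by simp
qed

lemma CHAR_eq_prime:
  assumes "Factorial_Ring.prime p" "CARD('a::{field,finite}) = p ^ n"
  shows "CHAR('a) = p"
proof -
  have c: "Factorial_Ring.prime CHAR('a)"
    by (rule prime_CHAR_semidom) (rule finite_imp_CHAR_pos, simp)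
  moreover have "CHAR('a) dvd p ^ n" using CHAR_dvd_CARD[where 'a = 'a] assms(2) by simp
  ultimately have "CHAR('a) dvd p" using prime_dvd_power by blast
  then show ?thesis using c assms(1) primes_dvd_imp_eq by blast
qed

locale finite_field_order =
  fixes ty :: "'a::{field,finite} itself" and p n :: nat
  assumes prime_p: "Factorial_Ring.prime p" and n_pos: "n \<ge> 1" and card_UNIV_eq: "CARD('a) = p ^ n"
begin

lemma CHAR_eq: "CHAR('a) = p"
  using CHAR_eq_prime[OF prime_p card_UNIV_eq] .

lemma p_of_power:
  assumes "d dvd CARD('a) - 1"
  obtains k where "k > 0" "p_of p d = p ^ k" "d dvd p_of p d - 1" "p_of p d > 1"
proof -
  have p1: "p > 1" by (rule prime_gt_1_nat[OF prime_p])
  have "[p ^ n = 1] (mod d)" using assms p1 unfolding card_UNIV_eq by (subst cong_altdef_nat) simp_all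
  then have "\<exists>k>0. p ^ n = p ^ k \<and> [p ^ n = 1] (mod d)" using n_pos by (intro exI[of _ n]) simp
  then have "\<exists>k>0. p_of p d = p ^ k \<and> [p_of p d = 1] (mod d)" unfolding p_of_def by (rule LeastI)
  then obtain k where k: "k > 0" "p_of p d = p ^ k" "[p_of p d = 1] (mod d)" by blast
  have "p_of p d > 1" unfolding k(2) by (rule one_less_power[OF p1 k(1)])
  moreover have "d dvd p_of p d - 1" using k(3) calculation cong_altdef_nat[of 1 "p_of p d" d] by simp
  ultimately show ?thesis using that k by blast
qed

text \<open>The least power of \<open>p\<close> that is 1 modulo \<open>d\<close> bounds from below any subfield containing the
  \<open>d\<close>-th roots of unity, as they form a subgroup of its multiplicative group.\<close>

lemma p_of_le_card_subfield:
  fixes L :: "'a set"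
  assumes d: "d dvd CARD('a) - 1" and L: "is_subfield L" "unity_roots d \<subseteq> L"
  shows "p_of p d \<le> card L"
proof -
  have "card {0, 1 :: 'a} \<le> CARD('a)" by (rule card_mono) auto
  then have d0: "d > 0" using d by (auto intro!: Nat.gr0I)
  have "card L dvd p ^ n" unfolding card_UNIV_eq[symmetric]
    by (rule is_add_subgroup_card_dvd) (use L in \<open>auto simp: is_subfield_def is_add_subgroup_def\<close>)
  then obtain j where j: "card L = p ^ j" using divides_primepow_nat[OF prime_p] by blast
  have "card {0, 1 :: 'a} \<le> card L"
    by (rule card_mono) (use L in \<open>auto simp: is_subfield_def is_add_subgroup_def\<close>)
  then have L2: "card L > 1" by simp
  then have "j > 0" using j by (auto intro!: Nat.gr0I)
  have "card (unity_roots d :: 'a set) dvd card (L - {0})"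
    by (rule mult_closed_card_dvd)
       (use L d0 in \<open>auto simp: is_subfield_def unity_roots_one unity_roots_mult unity_roots_zero\<close>)
  then have "d dvd card L - 1"
    using L by (simp add: power_image_unity_roots(2)[OF d] is_subfield_def is_add_subgroup_def)
  then have "[card L = 1] (mod d)" using L2 cong_altdef_nat[of 1 "card L" d] by simp
  then show ?thesis unfolding p_of_def by (intro Least_le) (use j \<open>j > 0\<close> in auto)
qed

context
  fixes d :: nat
  assumes d: "d dvd CARD('a) - 1"
begin

abbreviation root_field :: "'a set" where
  "root_field \<equiv> frobenius_fixed (p_of p d)"

lemma root_field_subfield: "is_subfield root_field"
  using frobenius_fixed_subfield[where 'a = 'a] p_of_power[OF d] prime_p CHAR_eq by metis

lemma unity_roots_subset_root_field: "unity_roots d \<subseteq> root_field"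
proof -
  obtain k where "d dvd p_of p d - 1" and r: "p_of p d > 1" using p_of_power[OF d] .
  then obtain m where m: "p_of p d - 1 = d * m" by blast
  have "x ^ p_of p d = x * x ^ (p_of p d - 1)" for x :: 'a using r by (simp flip: power_Suc)
  then show ?thesis using m by (auto simp: unity_roots_def frobenius_fixed_def power_mult)
qed

text \<open>The elements are the roots of \<open>X\<^sup>r - X\<close> with \<open>r = p_of p d\<close>, and there are at least \<open>r\<close> of them by
  the lower bound for subfields containing the \<open>d\<close>-th roots of unity.\<close>

lemma card_root_field: "card root_field = p_of p d"
proof -
  have "p_of p d > 1" using p_of_power[OF d] by blast
  then have "card root_field \<le> p_of p d"
    unfolding frobenius_fixed_def by (rule card_power_eq_self_le)
  then show ?thesis
    using p_of_le_card_subfield[OF d root_field_subfield unity_roots_subset_root_field] by simp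
qed

text \<open>The intersection with \<open>L\<close> is a subfield that still contains the \<open>d\<close>-th roots of unity, hence is not
  smaller than \<open>root_field\<close>.\<close>

lemma root_field_minimal:
  assumes "is_subfield L" "unity_roots d \<subseteq> L"
  shows "root_field \<subseteq> L"
proof -
  have "p_of p d \<le> card (L \<inter> root_field)"
    by (rule p_of_le_card_subfield[OF d])
      (use assms root_field_subfield unity_roots_subset_root_field in \<open>auto simp: is_subfield_Int\<close>)
  then have "L \<inter> root_field = root_field"
    by (intro card_seteq) (simp_all add: card_root_field)
  then show ?thesis by blast
qed

text \<open>By Lagrange the elements of \<open>L\<close> are fixed by the power map to the exponent \<open>|L|\<close>.\<close>

lemma subfield_eq_root_field:
  fixes L :: "'a set"
  assumes "is_subfield L" "card L = p_of p d"
  shows "L = root_field"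
proof -
  have "x ^ card L = x" if "x \<in> L" for x
  proof (cases "x = 0")
    case False
    have L0: "0 \<in> L" using assms by (simp add: is_subfield_def is_add_subgroup_def)
    have "x ^ card (L - {0}) = 1"
      by (rule mult_closed_power_card) (use assms that False in \<open>auto simp: is_subfield_def\<close>)
    moreover have "card L = Suc (card (L - {0}))" by (rule card.remove[OF _ L0]) simp
    ultimately show ?thesis by simp
  next
    case True
    then show ?thesis using that by (auto simp: power_0_left)
  qed
  then have "L \<subseteq> root_field" using assms(2) by (auto simp: frobenius_fixed_def)
  then show ?thesis by (rule card_subset_eq[rotated]) (simp_all add: card_root_field assms)
qed

text \<open>The subfield of order \<open>p_of p d\<close> is the one generated by the \<open>d\<close>-th roots of unity. This turns the
  module condition of the theorem into stability under roots of unity, which is what conjugation in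
  the affine group produces.\<close>

lemma root_field_multipliers_iff:
  fixes H :: "'a set"
  assumes "is_add_subgroup H"
  shows "root_field \<subseteq> multipliers H \<longleftrightarrow> unity_roots d \<subseteq> multipliers H"
proof
  assume "root_field \<subseteq> multipliers H"
  with unity_roots_subset_root_field show "unity_roots d \<subseteq> multipliers H" by (rule subset_trans)
next
  assume "unity_roots d \<subseteq> multipliers H"
  then show "root_field \<subseteq> multipliers H" by (rule root_field_minimal[OF multipliers_subfield[OF assms]])
qed

end

end

section \<open>Alternating sums over subspaces and over divisors\<close>

definition subspaces_between :: "'a::field set \<Rightarrow> 'a set \<Rightarrow> 'a set \<Rightarrow> 'a set set" where
  "subspaces_between K U W = {H. is_add_subgroup H \<and> K \<subseteq> multipliers H \<and> U \<subseteq> H \<and> H \<subseteq> W}"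

text \<open>The Moebius function of the quotient \<open>H/U\<close> over a field with \<open>r\<close> elements, with the dimension read
  off from the orders so that no quotient has to be formed.\<close>

definition subspace_mobius :: "nat \<Rightarrow> 'a set \<Rightarrow> 'a set \<Rightarrow> int" where
  "subspace_mobius r U H = (THE v. \<exists>l. card H = r ^ l * card U \<and> v = (-1) ^ l * int r ^ (l choose 2))"

definition adjoin :: "'a::field set \<Rightarrow> 'a \<Rightarrow> 'a set \<Rightarrow> 'a set" where
  "adjoin K w H = {k * w + h | k h. k \<in> K \<and> h \<in> H}"

lemma subspace_mobius_eq:
  assumes "r > 1" "card U > 0" "card H = r ^ l * card U"
  shows "subspace_mobius r U H = (-1) ^ l * int r ^ (l choose 2)"
  unfolding subspace_mobius_def
proof (rule the_equality)
  fix v assume "\<exists>l. card H = r ^ l * card U \<and> v = (-1) ^ l * int r ^ (l choose 2)"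
  then obtain l' where l': "card H = r ^ l' * card U" "v = (-1) ^ l' * int r ^ (l' choose 2)" by blast
  then have "r ^ l' = r ^ l" using assms by simp
  then have "l' = l" using assms(1) by (simp add: power_inject_exp)
  then show "v = (-1) ^ l * int r ^ (l choose 2)" using l' by simp
qed (use assms(3) in blast)

context
  fixes K :: "'a::{field,finite} set"
  assumes K: "is_subfield K"
begin

lemma card_subfield_gt_1: "card K > 1"
proof -
  have "card {0, 1 :: 'a} \<le> card K"
    by (rule card_mono) (use K in \<open>auto simp: is_subfield_def is_add_subgroup_def\<close>)
  then show ?thesis by simp
qed

lemma adjoin_props:
  assumes H: "is_add_subgroup H" "K \<subseteq> multipliers H"
  shows "is_add_subgroup (adjoin K w H)" "K \<subseteq> multipliers (adjoin K w H)"
    "H \<subseteq> adjoin K w H" "w \<in> adjoin K w H"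
proof -
  note K' = K[unfolded is_subfield_def]
  have in_adj: "k * w + h \<in> adjoin K w H" if "k \<in> K" "h \<in> H" for k h
    using that by (auto simp: adjoin_def)
  show sub: "H \<subseteq> adjoin K w H"
    using in_adj[of 0] K' by (auto simp: is_add_subgroup_def)
  show "w \<in> adjoin K w H" using in_adj[of 1 0] K' H(1) by (auto simp: is_add_subgroup_def)
  show "is_add_subgroup (adjoin K w H)"
    unfolding is_add_subgroup_def
  proof (intro conjI ballI)
    show "0 \<in> adjoin K w H" using sub H(1) by (auto simp: is_add_subgroup_def)
    fix x y assume "x \<in> adjoin K w H" "y \<in> adjoin K w H"
    then obtain k h k' h' where e: "x = k * w + h" "y = k' * w + h'" "k \<in> K" "k' \<in> K" "h \<in> H" "h' \<in> H"
      unfolding adjoin_def by blast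
    have "x - y = (k - k') * w + (h - h')" using e by (simp add: algebra_simps)
    moreover have "(k - k') * w + (h - h') \<in> adjoin K w H"
      by (rule in_adj) (use e K' H(1) in \<open>auto simp: is_add_subgroup_diff\<close>)
    ultimately show "x - y \<in> adjoin K w H" by (simp only:)
  qed
  show "K \<subseteq> multipliers (adjoin K w H)"
  proof
    fix k assume k: "k \<in> K"
    show "k \<in> multipliers (adjoin K w H)"
      unfolding multipliers_def
    proof (intro CollectI ballI)
      fix x assume "x \<in> adjoin K w H"
      then obtain k' h' where e: "x = k' * w + h'" "k' \<in> K" "h' \<in> H"
        unfolding adjoin_def by blast
      have "k * x = (k * k') * w + k * h'" using e by (simp add: algebra_simps)
      then show "k * x \<in> adjoin K w H" using in_adj[of "k * k'" "k * h'"] e K' H(2) k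
        by (auto dest: multipliersD subsetD)
    qed
  qed
qed

lemma adjoin_least:
  assumes "is_add_subgroup W" "K \<subseteq> multipliers W" "w \<in> W" "H \<subseteq> W"
  shows "adjoin K w H \<subseteq> W"
proof
  fix x assume "x \<in> adjoin K w H"
  then obtain k h where "x = k * w + h" "k \<in> K" "h \<in> H" unfolding adjoin_def by blast
  then show "x \<in> W" using assms by (auto intro!: is_add_subgroup_add multipliersD)
qed

lemma scalar_zero_if_notin:
  assumes H: "is_add_subgroup H" "K \<subseteq> multipliers H" "w \<notin> H" and k: "k \<in> K" "k * w \<in> H"
  shows "k = 0"
proof (rule ccontr)
  assume "k \<noteq> 0"
  have "inverse k * (k * w) \<in> H" using H k K unfolding is_subfield_def by (blast intro: multipliersD)
  then show False using H(3) \<open>k \<noteq> 0\<close> by (simp flip: mult.assoc)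
qed

lemma card_adjoin:
  assumes H: "is_add_subgroup H" "K \<subseteq> multipliers H" "w \<notin> H"
  shows "card (adjoin K w H) = card K * card H"
proof -
  have "inj_on (\<lambda>(k, h). k * w + h) (K \<times> H)"
  proof (rule inj_onI, clarify)
    fix k h k' h' assume e: "k \<in> K" "k' \<in> K" "h \<in> H" "h' \<in> H" "k * w + h = k' * w + h'"
    have "(k - k') * w = h' - h" using e(5) by (simp add: algebra_simps)
    then have "(k - k') * w \<in> H" using e H(1) by (simp add: is_add_subgroup_diff)
    moreover have "k - k' \<in> K" using e K by (simp add: is_subfield_def is_add_subgroup_diff)
    ultimately have "k - k' = 0" using scalar_zero_if_notin H by blast
    then show "k = k' \<and> h = h'" using e(5) by simp
  qed
  moreover have "adjoin K w H = (\<lambda>(k, h). k * w + h) ` (K \<times> H)" by (auto simp: adjoin_def)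
  ultimately show ?thesis by (simp add: card_image card_cartesian_product)
qed

text \<open>Adjoining a vector outside a subspace multiplies its order by \<open>|K|\<close>.\<close>

lemma card_subspace:
  assumes "is_add_subgroup U" "K \<subseteq> multipliers U" "is_add_subgroup W" "K \<subseteq> multipliers W" "U \<subseteq> W"
  obtains l where "card W = card K ^ l * card U"
  using assms
proof (induction "card W - card U" arbitrary: U thesis rule: less_induct)
  case less
  show ?case
  proof (cases "U = W")
    case True
    then show ?thesis using less.prems(1)[of 0] by simp
  next
    case False
    then obtain w where w: "w \<in> W" "w \<notin> U" using less.prems by blast
    note adj = adjoin_props[OF less.prems(2,3), of w]
    have sub: "adjoin K w U \<subseteq> W" by (rule adjoin_least) (use less.prems w in auto)
    have "card U < card (adjoin K w U)" by (rule psubset_card_mono) (use adj w in auto)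
    moreover have "card (adjoin K w U) \<le> card W" by (rule card_mono[OF _ sub]) simp
    ultimately have "card W - card (adjoin K w U) < card W - card U" by linarith
    then obtain l where "card W = card K ^ l * card (adjoin K w U)"
      using less.hyps[OF _ _ adj(1,2) less.prems(4,5) sub] by blast
    then show ?thesis using less.prems(1)[of "Suc l"] card_adjoin[OF less.prems(2,3) w(2)]
      by (simp add: mult_ac)
  qed
qed

lemma hyperplane_exists:
  assumes U: "is_add_subgroup U" "K \<subseteq> multipliers U" and W: "is_add_subgroup W" "K \<subseteq> multipliers W"
    and UW: "U \<subset> W"
  obtains M where "M \<in> subspaces_between K U W" "M \<noteq> W" "\<And>w. w \<in> W - M \<Longrightarrow> adjoin K w M = W"
proof -
  have "U \<in> subspaces_between K U W - {W}" using assms by (auto simp: subspaces_between_def)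
  then obtain M where M: "M \<in> subspaces_between K U W - {W}"
    and max: "\<And>M'. M' \<in> subspaces_between K U W - {W} \<Longrightarrow> M \<subseteq> M' \<Longrightarrow> M = M'"
    using finite_has_maximal[of "subspaces_between K U W - {W}"] by auto
  have M': "is_add_subgroup M" "K \<subseteq> multipliers M" "U \<subseteq> M" "M \<subseteq> W"
    using M by (auto simp: subspaces_between_def)
  have "adjoin K w M = W" if w: "w \<in> W - M" for w
  proof (rule ccontr)
    assume "adjoin K w M \<noteq> W"
    then have "adjoin K w M \<in> subspaces_between K U W - {W}"
      using adjoin_props[OF M'(1,2), of w] adjoin_least[OF W, of w M] M' w
      by (auto simp: subspaces_between_def)
    then show False using max adjoin_props(3,4)[OF M'(1,2), of w] w by blast
  qed
  then show ?thesis using that M by blast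
qed

text \<open>The subspaces \<open>H\<close> of \<open>W\<close> outside the hyperplane \<open>M\<close> with \<open>H \<inter> M = H'\<close> are the spaces \<open>Kw + H'\<close> with
  \<open>w\<close> in \<open>W - M\<close>. Their parts outside \<open>M\<close>, each of size \<open>(|K| - 1)|H'|\<close>, partition \<open>W - M\<close>, which has
  \<open>(|K| - 1)|M|\<close> elements.\<close>

lemma card_complements_in_hyperplane:
  assumes M: "is_add_subgroup M" "K \<subseteq> multipliers M" and W: "is_add_subgroup W" "K \<subseteq> multipliers W"
    and MW: "M \<subset> W" and hyp: "\<And>w. w \<in> W - M \<Longrightarrow> adjoin K w M = W"
    and H': "is_add_subgroup H'" "K \<subseteq> multipliers H'" "H' \<subseteq> M"
  defines "F \<equiv> {H. is_add_subgroup H \<and> K \<subseteq> multipliers H \<and> H \<subseteq> W \<and> \<not> H \<subseteq> M \<and> H \<inter> M = H'}"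
  shows "card F * card H' = card M" and "\<And>H. H \<in> F \<Longrightarrow> card H = card K * card H'"
proof -
  have eq: "H = adjoin K w H'" if H: "H \<in> F" and w: "w \<in> H - M" for H w
  proof
    show "adjoin K w H' \<subseteq> H" by (rule adjoin_least) (use H w in \<open>auto simp: F_def\<close>)
    show "H \<subseteq> adjoin K w H'"
    proof
      fix x assume x: "x \<in> H"
      have "x \<in> adjoin K w M" using hyp[of w] H w x by (auto simp: F_def)
      then obtain k m where km: "x = k * w + m" "k \<in> K" "m \<in> M" by (auto simp: adjoin_def)
      have Hs: "is_add_subgroup H" "K \<subseteq> multipliers H" using H by (auto simp: F_def)
      have "m = x - k * w" using km by simp
      also have "\<dots> \<in> H" by (rule is_add_subgroup_diff[OF Hs(1) x]) (use Hs(2) km w in \<open>auto intro: multipliersD\<close>)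
      finally have "m \<in> H'" using H km by (auto simp: F_def)
      then show "x \<in> adjoin K w H'" using km by (auto simp: adjoin_def)
    qed
  qed
  show c: "card H = card K * card H'" if H: "H \<in> F" for H
  proof -
    obtain w where w: "w \<in> H - M" using H by (auto simp: F_def)
    then show ?thesis using eq[OF H w] card_adjoin[OF H'(1,2), of w] H' by auto
  qed
  have adjF: "adjoin K w H' \<in> F" if w: "w \<in> W - M" for w
  proof -
    have "adjoin K w H' \<subseteq> W" by (rule adjoin_least) (use W w H'(3) MW in auto)
    moreover have "x \<in> H'" if x: "x \<in> adjoin K w H'" "x \<in> M" for x
    proof -
      obtain k h where kh: "x = k * w + h" "k \<in> K" "h \<in> H'" using x(1) by (auto simp: adjoin_def)
      have "k * w = x - h" using kh by simp
      also have "\<dots> \<in> M" by (rule is_add_subgroup_diff[OF M(1) x(2)]) (use kh H'(3) in auto)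
      finally have "k = 0" using scalar_zero_if_notin[OF M, of w k] w kh by auto
      then show ?thesis using kh by simp
    qed
    ultimately show ?thesis using adjoin_props[OF H'(1,2), of w] w H'(3) unfolding F_def by blast
  qed
  have "W - M = (\<Union>H\<in>F. H - M)"
  proof
    show "W - M \<subseteq> (\<Union>H\<in>F. H - M)"
    proof
      fix w assume w: "w \<in> W - M"
      then show "w \<in> (\<Union>H\<in>F. H - M)" using adjF[OF w] adjoin_props(4)[OF H'(1,2), of w] by blast
    qed
  qed (auto simp: F_def)
  moreover have "card (\<Union>H\<in>F. H - M) = (\<Sum>H\<in>F. card (H - M))"
  proof (rule card_UN_disjoint)
    show "\<forall>H\<in>F. \<forall>J\<in>F. H \<noteq> J \<longrightarrow> (H - M) \<inter> (J - M) = {}"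
      using eq by blast
  qed simp_all
  moreover have "card (H - M) = (card K - 1) * card H'" if H: "H \<in> F" for H
  proof -
    have "card (H - M) = card H - card H'"
      using H card_Diff_subset_Int[of H M] by (simp add: F_def)
    then show ?thesis using c[OF H] by (simp add: diff_mult_distrib)
  qed
  ultimately have "card (W - M) = card F * ((card K - 1) * card H')" by simp
  moreover have "card (W - M) = (card K - 1) * card M"
  proof -
    obtain w where w: "w \<in> W - M" using MW by blast
    have "card W = card K * card M" using card_adjoin[OF M, of w] hyp[OF w] w by simp
    then show ?thesis using MW by (simp add: card_Diff_subset psubset_imp_subset diff_mult_distrib)
  qed
  ultimately have "(card K - 1) * (card F * card H') = (card K - 1) * card M" by (metis mult.left_commute)
  then show "card F * card H' = card M" using card_subfield_gt_1 by simp
qed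

text \<open>Fix a hyperplane \<open>M\<close>, of codimension \<open>m\<close> over \<open>U\<close>. A subspace \<open>H\<close> outside \<open>M\<close> meets it in a
  hyperplane \<open>H'\<close> of \<open>H\<close>, and the \<open>|M|/|H'|\<close> choices of \<open>H\<close> over a given \<open>H'\<close> contribute
  \<open>-r\<^sup>m\<close> times the term of \<open>H'\<close>. So the sum for \<open>W\<close> is \<open>1 - r\<^sup>m\<close> times the sum for \<open>M\<close>.\<close>

lemma sum_subspace_mobius:
  assumes U: "is_add_subgroup U" "K \<subseteq> multipliers U" and W: "is_add_subgroup W" "K \<subseteq> multipliers W"
    and UW: "U \<subseteq> W"
  shows "(\<Sum>H\<in>subspaces_between K U W. subspace_mobius (card K) U H) = (if U = W then 1 else 0)"
  using W UW
proof (induction "card W" arbitrary: W rule: less_induct)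
  case (less W)
  note W = less.prems(1,2)
  let ?r = "card K"
  let ?v = "subspace_mobius ?r U"
  have U0: "card U > 0" using U(1) by (auto simp: card_gt_0_iff is_add_subgroup_def)
  note v = subspace_mobius_eq[OF card_subfield_gt_1 U0]
  show ?case
  proof (cases "U = W")
    case True
    then have "subspaces_between K U W = {U}" using U by (auto simp: subspaces_between_def)
    then show ?thesis using v[of U 0] True by (simp add: numeral_2_eq_2)
  next
    case False
    then have "U \<subset> W" using less.prems by blast
    then obtain M where M: "M \<in> subspaces_between K U W" "M \<noteq> W" 
      and hyp: "\<And>w. w \<in> W - M \<Longrightarrow> adjoin K w M = W"
      using hyperplane_exists[OF U W] by metis
    have M': "is_add_subgroup M" "K \<subseteq> multipliers M" "U \<subseteq> M" "M \<subset> W"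
      using M by (auto simp: subspaces_between_def)
    obtain m where m: "card M = ?r ^ m * card U" using card_subspace[OF U M'(1,2,3)] .
    define N where "N = {H \<in> subspaces_between K U W. \<not> H \<subseteq> M}"
    have "subspaces_between K U W = subspaces_between K U M \<union> N" "subspaces_between K U M \<inter> N = {}"
      using M' by (auto simp: subspaces_between_def N_def)
    then have "(\<Sum>H\<in>subspaces_between K U W. ?v H) = (\<Sum>H\<in>subspaces_between K U M. ?v H) + (\<Sum>H\<in>N. ?v H)"
      by (simp add: sum.union_disjoint)
    also have "(\<Sum>H\<in>N. ?v H) = (\<Sum>H'\<in>subspaces_between K U M. \<Sum>H | H \<in> N \<and> H \<inter> M = H'. ?v H)"
      using M' by (intro sum.group[symmetric])
        (auto simp: N_def subspaces_between_def is_add_subgroup_Int multipliers_def)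
    also have "\<dots> = (\<Sum>H'\<in>subspaces_between K U M. - int (?r ^ m) * ?v H')"
    proof (rule sum.cong[OF refl])
      fix H' assume H': "H' \<in> subspaces_between K U M"
      define F where "F = {H. is_add_subgroup H \<and> K \<subseteq> multipliers H \<and> H \<subseteq> W \<and> \<not> H \<subseteq> M \<and> H \<inter> M = H'}"
      have sub: "is_add_subgroup H'" "K \<subseteq> multipliers H'" "U \<subseteq> H'" "H' \<subseteq> M"
        using H' by (auto simp: subspaces_between_def)
      note cF = card_complements_in_hyperplane[OF M'(1,2) W M'(4) hyp sub(1,2,4), folded F_def]
      obtain k where k: "card H' = ?r ^ k * card U" using card_subspace[OF U sub(1,2,3)] .
      have "?v H = - (int (?r ^ k) * ?v H')" if "H \<in> F" for H
      proof -
        have "card H = ?r ^ Suc k * card U" using cF(2)[OF _ that] k by simp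
        then show ?thesis using v[of H "Suc k"] v[OF k]
          by (simp add: numeral_2_eq_2 power_add)
      qed
      moreover have "{H. H \<in> N \<and> H \<inter> M = H'} = F"
        using sub by (auto simp: N_def F_def subspaces_between_def)
      ultimately have "(\<Sum>H | H \<in> N \<and> H \<inter> M = H'. ?v H) = - int (card F * ?r ^ k) * ?v H'"
        by simp
      also have "card F * ?r ^ k = ?r ^ m"
      proof -
        have "card F * ?r ^ k * card U = ?r ^ m * card U" using cF(1) k m by (simp add: mult.assoc)
        then show ?thesis by (metis U0 less_irrefl mult_cancel2)
      qed
      finally show "(\<Sum>H | H \<in> N \<and> H \<inter> M = H'. ?v H) = - int (?r ^ m) * ?v H'" .
    qed
    also have "\<dots> = - int (?r ^ m) * (\<Sum>H'\<in>subspaces_between K U M. ?v H')"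
      by (simp add: sum_distrib_left)
    also have "(\<Sum>H'\<in>subspaces_between K U M. ?v H') = (if U = M then 1 else 0)"
      by (rule less.hyps) (use M' in \<open>auto intro: psubset_card_mono\<close>)
    finally have sum_W: "(\<Sum>H\<in>subspaces_between K U W. ?v H) = (if U = M then 1 else 0) + - int (?r ^ m) * (if U = M then 1 else 0)" .
    have "m = 0" if "U = M"
    proof (rule ccontr)
      assume "m \<noteq> 0"
      then have "1 < ?r ^ m" using one_less_power[OF card_subfield_gt_1] by blast
      then show False using m U0 unfolding that by simp
    qed
    then show ?thesis unfolding sum_W using \<open>U \<noteq> W\<close> by simp
  qed
qed

end

lemma mobius_nat_prime_mult:
  assumes p: "Factorial_Ring.prime p" and e: "e > 0" "\<not> p dvd e"
  shows "mobius_nat (p * e) = - mobius_nat e"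
proof -
  have "prime_factors (p * e) = insert p (prime_factors e)"
    using p e by (simp add: prime_factors_product prime_prime_factors)
  moreover have "p \<notin> prime_factors e" using e by auto
  moreover have "coprime p e" using p e prime_imp_coprime by blast
  then have "squarefree (p * e) \<longleftrightarrow> squarefree e"
    using squarefree_mult_coprime[of p e] squarefree_prime[OF p] squarefree_multD(2)[of p e] by blast
  ultimately show ?thesis by (simp add: mobius_nat_def)
qed

text \<open>Multiplication by a fixed prime divisor \<open>p\<close> of \<open>n\<close> pairs the squarefree divisors prime to \<open>p\<close>
  with those divisible by \<open>p\<close>, with opposite signs.\<close>

lemma sum_mobius_nat:
  assumes "n > 0"
  shows "(\<Sum>e | e dvd n. mobius_nat e) = (if n = 1 then 1 else 0)"
proof (cases "n = 1")
  case False
  then obtain p where p: "Factorial_Ring.prime p" "p dvd n" using prime_factor_nat by blast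
  define A where "A = {e. e dvd n \<and> squarefree e \<and> \<not> p dvd e}"
  define B where "B = {e. e dvd n \<and> squarefree e \<and> p dvd e}"
  have fin: "finite {e. e dvd n}" using assms by (simp add: finite_divisors_nat)
  have "(\<Sum>e | e dvd n. mobius_nat e) = (\<Sum>e\<in>A \<union> B. mobius_nat e)"
    by (rule sum.mono_neutral_right[OF fin]) (auto simp: A_def B_def mobius_nat_def)
  also have "\<dots> = (\<Sum>e\<in>A. mobius_nat e) + (\<Sum>e\<in>B. mobius_nat e)"
    by (rule sum.union_disjoint) (auto simp: A_def B_def intro: finite_subset[OF _ fin])
  also have "(\<Sum>e\<in>B. mobius_nat e) = (\<Sum>e\<in>A. - mobius_nat e)"
  proof (rule sum.reindex_bij_witness[of _ "\<lambda>e. p * e" "\<lambda>e. e div p"])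
    fix e assume e: "e \<in> A"
    have e0: "e > 0" using e assms by (auto simp: A_def intro!: Nat.gr0I)
    have cop: "coprime p e" using p(1) e prime_imp_coprime by (auto simp: A_def)
    show "p * e div p = e" using p by (simp add: prime_gt_0_nat)
    show "p * e \<in> B" using e cop p divides_mult[of p n e] squarefree_mult_coprime[OF cop]
      by (auto simp: A_def B_def squarefree_prime)
  next
    fix e assume e: "e \<in> B"
    then obtain f where f: "e = p * f" by (auto simp: B_def)
    have p0: "p > 0" using p by (simp add: prime_gt_0_nat)
    have nf: "\<not> p dvd f"
    proof
      assume "p dvd f"
      then have "p\<^sup>2 dvd e" unfolding f power2_eq_square by (rule mult_dvd_mono[OF dvd_refl])
      moreover have "squarefree e" using e by (simp add: B_def)
      ultimately have "p dvd 1" by (rule squarefreeD[rotated])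
      then show False using p(1) by simp
    qed
    show "p * (e div p) = e" using f p0 by simp
    show "e div p \<in> A" using e nf p0 squarefree_multD(2)[of p f] dvd_mult_right[of p f n]
      by (auto simp: f A_def B_def)
    have "f > 0" using e f assms by (auto simp: B_def intro!: Nat.gr0I)
    then show "- mobius_nat (e div p) = mobius_nat e"
      using mobius_nat_prime_mult[OF p(1), of f] nf f p0 by simp
  qed
  finally show ?thesis using False by (simp add: sum_negf)
qed (simp add: mobius_nat_def)

text \<open>The defining recurrence determines the Moebius function with fixed lower argument \<open>S\<close> on the
  subgroups above \<open>S\<close>, so a closed formula has to be checked against the recurrence only.\<close>

lemma mobius_subgroup_lattice_eqI:
  fixes G :: "'b::finite monoid" and f :: "'b set \<Rightarrow> int"
  assumes m: "is_mobius_function (subgroup_lattice G) m"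
    and S: "subgroup S G"
    and f: "\<And>T. subgroup T G \<Longrightarrow> S \<subseteq> T \<Longrightarrow>
      (\<Sum>N | subgroup N G \<and> S \<subseteq> N \<and> N \<subseteq> T. f N) = (if S = T then 1 else 0)"
    and T: "subgroup T G" "S \<subseteq> T"
  shows "m S T = f T"
  using T
proof (induction "card T" arbitrary: T rule: less_induct)
  case (less T)
  let ?I = "{N. subgroup N G \<and> S \<subseteq> N \<and> N \<subseteq> T}"
  have "(\<Sum>N\<in>?I. m S N) = (\<Sum>N\<in>?I. f N)"
    using m S f less.prems unfolding is_mobius_function_def subgroup_lattice_def by simp
  moreover have "(\<Sum>N\<in>?I - {T}. m S N) = (\<Sum>N\<in>?I - {T}. f N)"
    by (rule sum.cong[OF refl], rule less.hyps) (auto intro: psubset_card_mono)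
  moreover have "T \<in> ?I" using less.prems by simp
  ultimately show ?case using sum.remove[of ?I T "m S"] sum.remove[of ?I T f] by simp
qed

section \<open>Subgroups of the affine group\<close>

definition linear_parts :: "('a::field ^ 2 ^ 2) set \<Rightarrow> 'a set" where
  "linear_parts S = {a. \<exists>b. affine_mat a b \<in> S}"

definition translation_parts :: "('a::field ^ 2 ^ 2) set \<Rightarrow> 'a set" where
  "translation_parts S = {h. affine_mat 1 h \<in> S}"

text \<open>The maps \<open>t \<mapsto> xt + y\<close> with \<open>x\<^sup>d = 1\<close> that fix the point \<open>c\<close> modulo \<open>H\<close>.\<close>

definition fixing_subgroup :: "nat \<Rightarrow> 'a::field \<Rightarrow> 'a set \<Rightarrow> ('a ^ 2 ^ 2) set" where
  "fixing_subgroup d c H = {affine_mat x y | x y. x \<in> unity_roots d \<and> x * c + y - c \<in> H}"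

lemma affine_mat_in_fixing_subgroup:
  "affine_mat x y \<in> fixing_subgroup d c H \<longleftrightarrow> x \<in> unity_roots d \<and> x * c + y - c \<in> H"
  by (auto simp: fixing_subgroup_def affine_mat_eq_iff)

lemma inv_affine_mat:
  assumes "a \<noteq> (0::'a::field)"
  shows "inv\<^bsub>AGL1\<^esub> (affine_mat a b) = affine_mat (inverse a) (- inverse a * b)"
proof (rule group.inv_equality[OF group_AGL1])
  show "affine_mat (inverse a) (- inverse a * b) \<otimes>\<^bsub>AGL1\<^esub> affine_mat a b = \<one>\<^bsub>AGL1\<^esub>"
    using assms by (simp add: AGL1_def GL2_def affine_mat_mult affine_mat_one[symmetric] affine_mat_eq_iff)
qed (use assms in \<open>auto simp: carrier_AGL1\<close>)

lemma mult_AGL1: "A \<otimes>\<^bsub>AGL1\<^esub> B = A ** B"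
  by (simp add: AGL1_def GL2_def)

lemma one_AGL1: "\<one>\<^bsub>AGL1\<^esub> = affine_mat 1 0"
  by (simp add: AGL1_def GL2_def affine_mat_one)

lemma fixing_subgroup_subgroup:
  fixes H :: "'a::{field,finite} set"
  assumes d: "d > 0" and H: "is_add_subgroup H" "unity_roots d \<subseteq> multipliers H"
  shows "subgroup (fixing_subgroup d c H) AGL1"
proof (rule group.subgroupI[OF group_AGL1])
  have ne: "x \<noteq> 0" if "x \<in> unity_roots d" for x :: 'a
    using that unity_roots_zero[OF d] by blast
  show "fixing_subgroup d c H \<subseteq> carrier AGL1"
    using ne by (auto simp: fixing_subgroup_def carrier_AGL1)
  have "affine_mat 1 0 \<in> fixing_subgroup d c H"
    using H by (simp add: affine_mat_in_fixing_subgroup unity_roots_one is_add_subgroup_def)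
  then show "fixing_subgroup d c H \<noteq> {}" by blast
  fix A B assume "A \<in> fixing_subgroup d c H" "B \<in> fixing_subgroup d c H"
  then obtain x y x' y' where A: "A = affine_mat x y" "x \<in> unity_roots d" "x * c + y - c \<in> H"
    and B: "B = affine_mat x' y'" "x' \<in> unity_roots d" "x' * c + y' - c \<in> H"
    unfolding fixing_subgroup_def by blast
  have "x * (x' * c + y' - c) + (x * c + y - c) \<in> H"
    by (rule is_add_subgroup_add[OF H(1)]) (use A B H(2) in \<open>auto intro: multipliersD\<close>)
  then show "A \<otimes>\<^bsub>AGL1\<^esub> B \<in> fixing_subgroup d c H"
    using A B by (simp add: mult_AGL1 affine_mat_mult affine_mat_in_fixing_subgroup unity_roots_mult algebra_simps)
  have ix: "inverse x \<in> unity_roots d" using A by (simp add: unity_roots_def power_inverse)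
  have "- (inverse x * (x * c + y - c)) \<in> H"
    by (rule is_add_subgroup_minus[OF H(1)]) (use A ix H(2) in \<open>auto intro: multipliersD\<close>)
  then show "inv\<^bsub>AGL1\<^esub> A \<in> fixing_subgroup d c H"
    using A ix ne[OF A(2)] by (simp add: inv_affine_mat affine_mat_in_fixing_subgroup algebra_simps)
qed

lemma linear_parts_fixing_subgroup:
  assumes "is_add_subgroup H"
  shows "linear_parts (fixing_subgroup d c H) = unity_roots d"
proof -
  have "x * c + (c - x * c) - c \<in> H" for x using assms by (simp add: is_add_subgroup_def)
  then show ?thesis unfolding linear_parts_def affine_mat_in_fixing_subgroup by blast
qed

lemma translation_parts_fixing_subgroup: "translation_parts (fixing_subgroup d c H) = H"
  by (simp add: translation_parts_def affine_mat_in_fixing_subgroup unity_roots_one)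

lemma linear_parts_mono: "S \<subseteq> T \<Longrightarrow> linear_parts S \<subseteq> linear_parts T"
  by (auto simp: linear_parts_def)

lemma translation_parts_mono: "S \<subseteq> T \<Longrightarrow> translation_parts S \<subseteq> translation_parts T"
  by (auto simp: translation_parts_def)

locale affine_subgroup =
  fixes S :: "('a::{field,finite} ^ 2 ^ 2) set"
  assumes subgroup_S: "subgroup S AGL1"
begin

lemma mem_affine:
  assumes "A \<in> S"
  obtains a b where "A = affine_mat a b" "a \<noteq> 0"
  using assms subgroup.subset[OF subgroup_S] by (auto simp: carrier_AGL1)

lemma mem_nonzero: "affine_mat a b \<in> S \<Longrightarrow> a \<noteq> 0"
  by (metis mem_affine affine_mat_eq_iff)

lemma mem_one: "affine_mat 1 0 \<in> S"
  using subgroup.one_closed[OF subgroup_S] by (simp add: one_AGL1)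

lemma mem_mult: "affine_mat a b \<in> S \<Longrightarrow> affine_mat c d \<in> S \<Longrightarrow> affine_mat (a * c) (a * d + b) \<in> S"
  using subgroup.m_closed[OF subgroup_S] by (metis mult_AGL1 affine_mat_mult)

lemma mem_inv: "affine_mat a b \<in> S \<Longrightarrow> affine_mat (inverse a) (- inverse a * b) \<in> S"
  using subgroup.m_inv_closed[OF subgroup_S] mem_nonzero by (metis inv_affine_mat)

lemma mem_same_linear_part:
  assumes "affine_mat a b \<in> S" "affine_mat a b' \<in> S"
  shows "b - b' \<in> translation_parts S"
proof -
  have "affine_mat (a * inverse a) (a * (- inverse a * b') + b) \<in> S"
    by (rule mem_mult[OF assms(1) mem_inv[OF assms(2)]])
  then show ?thesis using mem_nonzero[OF assms(1)] by (simp add: translation_parts_def mult.assoc[symmetric])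
qed

lemma mem_translate:
  assumes "affine_mat a b' \<in> S" "b - b' \<in> translation_parts S"
  shows "affine_mat a b \<in> S"
  using mem_mult[of 1 "b - b'" a b'] assms by (simp add: translation_parts_def add.commute)

lemma translation_parts_add_subgroup: "is_add_subgroup (translation_parts S)"
  using mem_one mem_same_linear_part[of 1] by (auto simp: is_add_subgroup_def translation_parts_def)

lemma linear_parts_one: "1 \<in> linear_parts S"
  using mem_one by (auto simp: linear_parts_def)

lemma linear_parts_zero: "0 \<notin> linear_parts S"
  using mem_nonzero by (auto simp: linear_parts_def)

lemma linear_parts_mult: "x \<in> linear_parts S \<Longrightarrow> y \<in> linear_parts S \<Longrightarrow> x * y \<in> linear_parts S"
  using mem_mult unfolding linear_parts_def by blast

lemmas linear_parts_eq = mult_closed_eq_unity_roots(1)[OF linear_parts_one linear_parts_zero linear_parts_mult]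
  and card_linear_parts_dvd = mult_closed_eq_unity_roots(2)[OF linear_parts_one linear_parts_zero linear_parts_mult]

lemma card_linear_parts_dvd_mono:
  assumes "affine_subgroup T" "S \<subseteq> T"
  shows "card (linear_parts S) dvd card (linear_parts T)"
proof -
  interpret T: affine_subgroup T by fact
  show ?thesis
    by (rule mult_closed_card_dvd)
      (simp_all add: T.linear_parts_zero T.linear_parts_mult linear_parts_one linear_parts_mult
        linear_parts_mono[OF assms(2)])
qed

lemma linear_parts_multipliers: "linear_parts S \<subseteq> multipliers (translation_parts S)"
proof
  fix a assume "a \<in> linear_parts S"
  then obtain b where b: "affine_mat a b \<in> S" by (auto simp: linear_parts_def)
  show "a \<in> multipliers (translation_parts S)"
    unfolding multipliers_def
  proof (intro CollectI ballI)
    fix h assume "h \<in> translation_parts S"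
    then have "affine_mat a (a * h + b) \<in> S"
      using mem_mult[OF b, of 1 h] by (simp add: translation_parts_def)
    from mem_same_linear_part[OF this b] show "a * h \<in> translation_parts S" by simp
  qed
qed

text \<open>Commutators are translations. Comparing an element with one of linear part \<open>a \<noteq> 1\<close>, whose
  fixed point is \<open>c\<close>, shows that it moves \<open>c\<close> by a translation part multiplied by \<open>1/(1 - a)\<close>.\<close>

lemma eq_fixing_subgroup:
  assumes a: "affine_mat a b \<in> S" "a \<noteq> 1" "a * c + b = c"
  shows "S = fixing_subgroup (card (linear_parts S)) c (translation_parts S)"
proof -
  let ?W = "translation_parts S"
  note W = translation_parts_add_subgroup
  \<comment> \<open>division by \<open>1 - a\<close> preserves \<open>?W\<close>, as the multipliers form a field\<close>
  have mult: "is_subfield (multipliers ?W)" by (rule multipliers_subfield[OF W])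
  have "a \<in> multipliers ?W" using linear_parts_multipliers a(1) by (auto simp: linear_parts_def)
  then have inv: "inverse (1 - a) \<in> multipliers ?W"
    using mult by (auto simp: is_subfield_def is_add_subgroup_diff)
  have b: "b = c - a * c" using a(3) by (simp add: algebra_simps)
  have sub: "x * c + y - c \<in> ?W" if xy: "affine_mat x y \<in> S" for x y
  proof -
    have "affine_mat (x * a) (x * b + y) \<in> S" "affine_mat (x * a) (a * y + b) \<in> S"
      using mem_mult[OF xy a(1)] mem_mult[OF a(1) xy] by (simp_all add: mult.commute)
    then have "(x * b + y) - (a * y + b) \<in> ?W" by (rule mem_same_linear_part)
    also have "(x * b + y) - (a * y + b) = (1 - a) * (x * c + y - c)"
      by (simp add: b algebra_simps)
    finally have "inverse (1 - a) * ((1 - a) * (x * c + y - c)) \<in> ?W" by (rule multipliersD[OF inv])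
    then show ?thesis using a(2) by (simp flip: mult.assoc)
  qed
  have "affine_mat x y \<in> S \<longleftrightarrow> x \<in> linear_parts S \<and> x * c + y - c \<in> ?W" for x y
  proof
    assume R: "x \<in> linear_parts S \<and> x * c + y - c \<in> ?W"
    then obtain y' where y': "affine_mat x y' \<in> S" by (auto simp: linear_parts_def)
    have "(x * c + y - c) - (x * c + y' - c) \<in> ?W"
      by (rule is_add_subgroup_diff[OF W]) (use R sub[OF y'] in auto)
    then show "affine_mat x y \<in> S" using mem_translate[OF y'] by simp
  qed (use sub in \<open>auto simp: linear_parts_def\<close>)
  then have *: "affine_mat x y \<in> S \<longleftrightarrow> affine_mat x y \<in> fixing_subgroup (card (linear_parts S)) c ?W" for x y
    using linear_parts_eq affine_mat_in_fixing_subgroup by metis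
  show ?thesis
  proof
    show "S \<subseteq> fixing_subgroup (card (linear_parts S)) c ?W" using * mem_affine by (metis subsetI)
    show "fixing_subgroup (card (linear_parts S)) c ?W \<subseteq> S"
      using * unfolding fixing_subgroup_def by blast
  qed
qed

lemma eq_fixing_subgroup_trivial:
  assumes "card (linear_parts S) = 1"
  shows "S = fixing_subgroup 1 c (translation_parts S)"
proof -
  have "linear_parts S = {1}" using linear_parts_eq assms by simp
  then have one: "a = 1" if "affine_mat a b \<in> S" for a b using that by (auto simp: linear_parts_def)
  have "\<exists>h. A = affine_mat 1 h \<and> affine_mat 1 h \<in> S" if A: "A \<in> S" for A
  proof -
    obtain a b where "A = affine_mat a b" by (rule mem_affine[OF A])
    then show ?thesis using one[of a b] A by auto
  qed
  then show ?thesis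
    unfolding fixing_subgroup_def translation_parts_def by fastforce
qed

lemma eqI_parts:
  assumes "affine_subgroup T" "S \<subseteq> T" "linear_parts T \<subseteq> linear_parts S"
    "translation_parts T \<subseteq> translation_parts S"
  shows "S = T"
proof (intro equalityI subsetI)
  interpret T: affine_subgroup T by fact
  fix A assume A: "A \<in> T"
  then obtain x y where xy: "A = affine_mat x y" using T.mem_affine by metis
  then have "x \<in> linear_parts T" using A by (auto simp: linear_parts_def)
  then obtain y' where y': "affine_mat x y' \<in> S" using assms(3) by (auto simp: linear_parts_def)
  have "y - y' \<in> translation_parts S" using T.mem_same_linear_part[of x y y'] A xy y' assms by auto
  then show "A \<in> S" using mem_translate[OF y'] xy by simp
qed (use assms in auto)

end

lemma unity_roots_nontrivial:
  assumes "d dvd CARD('a::{field,finite}) - 1" "d \<noteq> 1"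
  obtains a :: "'a::{field,finite}" where "a \<in> unity_roots d" "a \<noteq> 1"
proof -
  have "\<exists>a \<in> unity_roots d. a \<noteq> (1 :: 'a)"
  proof (rule ccontr)
    assume "\<not> (\<exists>a \<in> unity_roots d. a \<noteq> (1 :: 'a))"
    then have "unity_roots d = {1 :: 'a}" using unity_roots_one[of d, where 'a = 'a] by blast
    then show False using power_image_unity_roots(2)[OF assms(1)] assms(2) by simp
  qed
  then show ?thesis using that by blast
qed

lemma fixing_subgroup_subset:
  assumes "d dvd e" "H \<subseteq> W" "is_add_subgroup W" "unity_roots e \<subseteq> multipliers W" "c - c' \<in> W"
  shows "fixing_subgroup d c H \<subseteq> fixing_subgroup e c' W"
proof
  fix A assume "A \<in> fixing_subgroup d c H"
  then obtain x y where A: "A = affine_mat x y" "x \<in> unity_roots d" "x * c + y - c \<in> H"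
    unfolding fixing_subgroup_def by blast
  have x: "x \<in> unity_roots e" using A(2) unity_roots_mono[OF assms(1)] by blast
  have "x * (c - c') \<in> W" using x assms(4,5) by (auto intro: multipliersD)
  then have "(x * c + y - c) - x * (c - c') \<in> W"
    by (rule is_add_subgroup_diff[OF assms(3) subsetD[OF assms(2) A(3)]])
  then have "(x * c + y - c) - x * (c - c') + (c - c') \<in> W"
    by (rule is_add_subgroup_add[OF assms(3) _ assms(5)])
  then show "A \<in> fixing_subgroup e c' W"
    using A x by (simp add: affine_mat_in_fixing_subgroup algebra_simps)
qed

lemma fixing_subgroup_subset_imp_point:
  fixes a c :: "'a::{field,finite}"
  assumes a: "a \<in> unity_roots d" "a \<noteq> 1" and H: "0 \<in> H"
    and W: "is_add_subgroup W" "unity_roots d \<subseteq> multipliers W"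
    and sub: "fixing_subgroup d c H \<subseteq> fixing_subgroup e c' W"
  shows "c - c' \<in> W"
proof -
  have "affine_mat a (c - a * c) \<in> fixing_subgroup d c H"
    using a H by (simp add: affine_mat_in_fixing_subgroup)
  then have "a * c' + (c - a * c) - c' \<in> W" using sub affine_mat_in_fixing_subgroup by blast
  also have "a * c' + (c - a * c) - c' = (1 - a) * (c - c')" by (simp add: algebra_simps)
  finally have *: "(1 - a) * (c - c') \<in> W" .
  have "inverse (1 - a) \<in> multipliers W"
    using multipliers_subfield[OF W(1)] subsetD[OF W(2) a(1)] unfolding is_subfield_def
    by (simp add: is_add_subgroup_diff)
  from multipliersD[OF this *] show ?thesis using a(2) by (simp flip: mult.assoc)
qed

section \<open>The recurrence of the Moebius function\<close>

lemma card_translate: "card {x. x - c \<in> H} = card (H :: 'a::ab_group_add set)"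
proof (rule bij_betw_same_card)
  show "bij_betw (\<lambda>x. x - c) {x. x - c \<in> H} H"
    by (rule bij_betwI[of _ _ _ "\<lambda>h. h + c"]) auto
qed

text \<open>The subgroups in question are given by the point they fix modulo \<open>H\<close>. If \<open>d1 \<noteq> 1\<close>, the lower
  bound contains elements of linear part \<open>\<noteq> 1\<close> fixing 0, which leaves the point 0 only. If \<open>d1 = 1\<close>
  and \<open>d \<noteq> 1\<close>, the point may be anywhere in a coset of \<open>W = translation_parts T\<close>, which gives
  \<open>|W|/|H|\<close> subgroups. If \<open>d = 1\<close>, there is only the group of translations by \<open>H\<close>.\<close>

lemma card_subgroups_with_parts:
  fixes T :: "('a::{field,finite} ^ 2 ^ 2) set" and U H :: "'a set"
  assumes T: "subgroup T AGL1" and S1: "fixing_subgroup d1 0 U \<subseteq> T"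
    and U: "is_add_subgroup U"
    and d: "d1 dvd d" "d dvd card (linear_parts T)"
    and H: "is_add_subgroup H" "unity_roots d \<subseteq> multipliers H" "U \<subseteq> H" "H \<subseteq> translation_parts T"
  defines "N \<equiv> {S. subgroup S AGL1 \<and> fixing_subgroup d1 0 U \<subseteq> S \<and> S \<subseteq> T \<and>
                   card (linear_parts S) = d \<and> translation_parts S = H}"
  shows "card N * (if d1 = 1 \<and> d \<noteq> 1 then card H else 1) =
           (if d1 = 1 \<and> d \<noteq> 1 then card (translation_parts T) else 1)"
proof -
  interpret T: affine_subgroup T by (rule affine_subgroup.intro) fact
  let ?W = "translation_parts T" and ?D = "card (linear_parts T)"
  note W = T.translation_parts_add_subgroup
  have Wm: "unity_roots ?D \<subseteq> multipliers ?W" using T.linear_parts_multipliers T.linear_parts_eq by simp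
  have dq: "d dvd CARD('a) - 1" using d(2) T.card_linear_parts_dvd by (rule dvd_trans)
  have d1q: "d1 dvd CARD('a) - 1" using d(1) dq by (rule dvd_trans)
  have cd: "card (unity_roots d :: 'a set) = d" by (rule power_image_unity_roots(2)[OF dq])
  have d0: "d > 0" using cd unity_roots_one[of d, where 'a = 'a] by (auto simp: card_gt_0_iff intro!: Nat.gr0I)
  have in_N: "fixing_subgroup d c H \<in> N"
    if "fixing_subgroup d c H \<subseteq> T" "fixing_subgroup d1 0 U \<subseteq> fixing_subgroup d c H" for c
    using that fixing_subgroup_subgroup[OF d0 H(1,2)] linear_parts_fixing_subgroup[OF H(1)] cd
    by (simp add: N_def translation_parts_fixing_subgroup)
  show ?thesis
  proof (cases "d1 = 1 \<and> d \<noteq> 1")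
    case True
    obtain a :: 'a where a: "a \<in> unity_roots d" "a \<noteq> 1" using unity_roots_nontrivial[OF dq] True by blast
    have "a \<in> linear_parts T" using a(1) unity_roots_mono[OF d(2)] T.linear_parts_eq by blast
    then obtain b where b: "affine_mat a b \<in> T" by (auto simp: linear_parts_def)
    \<comment> \<open>the fixed point of \<open>t \<mapsto> at + b\<close>\<close>
    define c0 where "c0 = b / (1 - a)"
    have "a * c0 + b = c0" using a(2) by (simp add: c0_def field_simps)
    from T.eq_fixing_subgroup[OF b a(2) this] have Teq: "T = fixing_subgroup ?D c0 ?W" .
    define C where "C = {c. c - c0 \<in> ?W}"
    have sub: "fixing_subgroup d c H \<subseteq> T" if "c \<in> C" for c
      by (subst Teq, rule fixing_subgroup_subset) (use d H W Wm that in \<open>auto simp: C_def\<close>)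
    have "fixing_subgroup d1 0 U \<subseteq> fixing_subgroup d c H" for c
      using True H(3) by (auto simp: fixing_subgroup_def unity_roots_one affine_mat_eq_iff)
    then have im: "(\<lambda>c. fixing_subgroup d c H) ` C \<subseteq> N" using in_N sub by blast
    moreover have "N \<subseteq> (\<lambda>c. fixing_subgroup d c H) ` C"
    proof
      fix S assume S: "S \<in> N"
      interpret S: affine_subgroup S using S by (intro affine_subgroup.intro) (simp add: N_def)
      have "a \<in> linear_parts S" using S.linear_parts_eq S a(1) by (simp add: N_def)
      then obtain b' where b': "affine_mat a b' \<in> S" by (auto simp: linear_parts_def)
      define c where "c = b' / (1 - a)"
      have "a * c + b' = c" using a(2) by (simp add: c_def field_simps)
      from S.eq_fixing_subgroup[OF b' a(2) this] have Seq: "S = fixing_subgroup d c H" using S by (simp add: N_def)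
      have "c - c0 \<in> ?W"
        by (rule fixing_subgroup_subset_imp_point[OF a, where H = H and e = ?D])
          (use S Seq Teq H W Wm unity_roots_mono[OF d(2)] in \<open>auto simp: N_def is_add_subgroup_def\<close>)
      then show "S \<in> (\<lambda>c. fixing_subgroup d c H) ` C" using Seq by (auto simp: C_def)
    qed
    ultimately have N: "N = (\<lambda>c. fixing_subgroup d c H) ` C" by blast
    have fib: "card {c \<in> C. fixing_subgroup d c H = fixing_subgroup d c' H} = card H" if c': "c' \<in> C" for c'
    proof -
      have "fixing_subgroup d c H = fixing_subgroup d c' H \<longleftrightarrow> c - c' \<in> H" for c
      proof
        assume "fixing_subgroup d c H = fixing_subgroup d c' H"
        then show "c - c' \<in> H"
          by (intro fixing_subgroup_subset_imp_point[OF a _ H(1,2), where H = H and e = d]) (use H in \<open>auto simp: is_add_subgroup_def\<close>)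
      next
        assume *: "c - c' \<in> H"
        then have "c' - c \<in> H" using is_add_subgroup_minus[OF H(1) *] by simp
        with * show "fixing_subgroup d c H = fixing_subgroup d c' H"
          using fixing_subgroup_subset[OF dvd_refl subset_refl H(1,2)] by blast
      qed
      moreover have "c \<in> C" if "c - c' \<in> H" for c
        using is_add_subgroup_add[OF W, of "c - c'" "c' - c0"] that c' H(4) by (auto simp: C_def)
      ultimately have "{c \<in> C. fixing_subgroup d c H = fixing_subgroup d c' H} = {c. c - c' \<in> H}"
        by blast
      then show ?thesis by (simp add: card_translate)
    qed
    have "card ?W = card C" by (simp add: C_def card_translate)
    also have "\<dots> = (\<Sum>S\<in>N. card {c \<in> C. fixing_subgroup d c H = S})"
      using sum.image_gen[of C "\<lambda>_. 1 :: nat" "\<lambda>c. fixing_subgroup d c H"] N by simp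
    also have "\<dots> = (\<Sum>S\<in>N. card H)" by (rule sum.cong[OF refl]) (use fib N in auto)
    also have "\<dots> = card N * card H" by simp
    finally show ?thesis using True by simp
  next
    case False
    have eq0: "S = fixing_subgroup (card (linear_parts S)) 0 (translation_parts S)"
      if S: "subgroup S AGL1" "fixing_subgroup d1 0 U \<subseteq> S" "d1 \<noteq> 1" for S
    proof -
      interpret S: affine_subgroup S by (rule affine_subgroup.intro) fact
      obtain a :: 'a where a: "a \<in> unity_roots d1" "a \<noteq> 1" using unity_roots_nontrivial[OF d1q S(3)] .
      have "affine_mat a 0 \<in> fixing_subgroup d1 0 U"
        using a U by (simp add: affine_mat_in_fixing_subgroup is_add_subgroup_def)
      then have "affine_mat a 0 \<in> S" using S(2) by blast
      then show ?thesis by (rule S.eq_fixing_subgroup[OF _ a(2)]) simp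
    qed
    have "S = fixing_subgroup d 0 H" if S: "S \<in> N" for S
    proof (cases "d1 = 1")
      case True
      interpret S: affine_subgroup S using S by (intro affine_subgroup.intro) (simp add: N_def)
      show ?thesis using S.eq_fixing_subgroup_trivial[of 0] S True False by (simp add: N_def)
    next
      case False
      then show ?thesis using eq0[of S] S by (simp add: N_def)
    qed
    moreover have "fixing_subgroup d 0 H \<subseteq> T"
    proof (cases "d1 = 1")
      case True
      then have "d = 1" using False by simp
      then show ?thesis using H(4) by (auto simp: fixing_subgroup_def translation_parts_def)
    next
      case False
      show ?thesis
        by (subst eq0[OF T S1 False], rule fixing_subgroup_subset)
          (use d H W Wm in \<open>auto simp: is_add_subgroup_def\<close>)
    qed
    moreover have "fixing_subgroup d1 0 U \<subseteq> fixing_subgroup d 0 H"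
      by (rule fixing_subgroup_subset) (use d H in \<open>auto simp: is_add_subgroup_def\<close>)
    ultimately have "N = {fixing_subgroup d 0 H}" using in_N by blast
    then show ?thesis using False by auto
  qed
qed

text \<open>The claimed Moebius function between subgroups with \<open>d1\<close> and \<open>d\<close> linear parts and translations
  \<open>U\<close> and \<open>H\<close>. The condition says that \<open>U\<close> is a module over the field generated by the \<open>d\<close>-th roots of
  unity (\<open>root_field_multipliers_iff\<close>).\<close>

definition interval_value :: "nat \<Rightarrow> nat \<Rightarrow> 'a::field set \<Rightarrow> nat \<Rightarrow> 'a set \<Rightarrow> int" where
  "interval_value p d1 U d H =
     (if unity_roots d \<subseteq> multipliers U
      then (if d1 = 1 \<and> d \<noteq> 1 then int (card H div card U) else 1) *
           mobius_nat (d div d1) * subspace_mobius (p_of p d) U H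
      else 0)"

lemma sum_mobius_nat_between:
  assumes "d1 dvd D" "D > 0"
  shows "(\<Sum>d | d1 dvd d \<and> d dvd D. mobius_nat (d div d1)) = (if d1 = D then 1 else 0)"
proof -
  obtain m where m: "D = d1 * m" using assms(1) by blast
  have p: "d1 > 0" "m > 0" using assms(2) m by auto
  have "(\<Sum>d | d1 dvd d \<and> d dvd D. mobius_nat (d div d1)) = (\<Sum>e | e dvd m. mobius_nat e)"
  proof (rule sum.reindex_bij_witness[of _ "\<lambda>e. d1 * e" "\<lambda>d. d div d1"])
    fix d assume d: "d \<in> {d. d1 dvd d \<and> d dvd D}"
    then obtain e where "d = d1 * e" by blast
    then show "d1 * (d div d1) = d" "d div d1 \<in> {e. e dvd m}" "mobius_nat (d div d1) = mobius_nat (d div d1)"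
      using d p by (simp_all add: m)
  qed (use p in \<open>simp_all add: m\<close>)
  then show ?thesis using sum_mobius_nat[OF p(2)] m p by auto
qed

context finite_field_order
begin

text \<open>Here \<open>N H\<close> stands for the number of subgroups with \<open>d\<close> linear parts and translations \<open>H\<close>. In the case \<open>d1 = 1\<close>,
  \<open>d \<noteq> 1\<close> the factor \<open>|H|/|U|\<close> of the value turns this number \<open>|W|/|H|\<close> into \<open>|W|/|U|\<close>, which does not
  depend on \<open>H\<close>. So a sum over subspaces remains, which vanishes unless \<open>U = W\<close>.\<close>

lemma sum_interval_value_fixed_order:
  fixes U W :: "'a set"
  assumes U: "is_add_subgroup U" and W: "is_add_subgroup W" "unity_roots d \<subseteq> multipliers W"
    and UW: "U \<subseteq> W" and dq: "d dvd CARD('a) - 1"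
    and N: "\<And>H. H \<in> subspaces_between (unity_roots d) U W \<Longrightarrow>
      N H * (if d1 = 1 \<and> d \<noteq> 1 then card H else 1) = (if d1 = 1 \<and> d \<noteq> 1 then card W else 1)"
  shows "(\<Sum>H\<in>subspaces_between (unity_roots d) U W. int (N H) * interval_value p d1 U d H) =
    (if U = W then mobius_nat (d div d1) else 0)"
proof (cases "unity_roots d \<subseteq> multipliers U")
  case True
  let ?K = "frobenius_fixed (p_of p d) :: 'a set"
  let ?c = "if d1 = 1 \<and> d \<noteq> 1 then int (card W div card U) else 1"
  note rf = root_field_multipliers_iff[OF dq]
  have U0: "card U > 0" using U by (auto simp: card_gt_0_iff is_add_subgroup_def)
  have "subspaces_between (unity_roots d) U W = subspaces_between ?K U W"
    using rf unfolding subspaces_between_def by blast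
  moreover have "int (N H) * interval_value p d1 U d H =
      ?c * mobius_nat (d div d1) * subspace_mobius (card ?K) U H"
    if H: "H \<in> subspaces_between (unity_roots d) U W" for H
  proof -
    have "card U dvd card H"
      by (rule is_add_subgroup_card_dvd) (use U H in \<open>auto simp: subspaces_between_def\<close>)
    then have "N H * (card H div card U) = card W div card U" if "d1 = 1 \<and> d \<noteq> 1"
      using N[OF H] that by (simp add: div_mult_swap)
    moreover have "N H = 1" if "\<not> (d1 = 1 \<and> d \<noteq> 1)" using N[OF H] that by (auto split: if_splits)
    ultimately have "int (N H) * (if d1 = 1 \<and> d \<noteq> 1 then int (card H div card U) else 1) = ?c"
      by (simp flip: of_nat_mult)
    moreover have "interval_value p d1 U d H = (if d1 = 1 \<and> d \<noteq> 1 then int (card H div card U) else 1) *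
        (mobius_nat (d div d1) * subspace_mobius (card ?K) U H)"
      using True by (simp only: interval_value_def if_True card_root_field[OF dq] mult.assoc)
    ultimately show ?thesis by (simp only: mult.assoc[symmetric])
  qed
  ultimately have "(\<Sum>H\<in>subspaces_between (unity_roots d) U W. int (N H) * interval_value p d1 U d H) =
      ?c * mobius_nat (d div d1) * (\<Sum>H\<in>subspaces_between ?K U W. subspace_mobius (card ?K) U H)"
    by (simp add: sum_distrib_left)
  also have "(\<Sum>H\<in>subspaces_between ?K U W. subspace_mobius (card ?K) U H) = (if U = W then 1 else 0)"
    by (rule sum_subspace_mobius[OF root_field_subfield[OF dq]]) (use U W UW rf True in auto)
  finally have total: "(\<Sum>H\<in>subspaces_between (unity_roots d) U W. int (N H) * interval_value p d1 U d H) =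
    ?c * mobius_nat (d div d1) * (if U = W then 1 else 0)" .
  have "card U div card U = 1" using U0 by (intro div_self) linarith
  then show ?thesis unfolding total by (cases "U = W") auto
next
  case False
  then show ?thesis using W by (auto simp: interval_value_def)
qed

text \<open>The recurrence. Grouping the subgroups \<open>S\<close> by \<open>d\<close> and \<open>H\<close> leaves a sum over the \<open>d\<close> between \<open>d1\<close> and
  the number of linear parts of \<open>T\<close>. It is nonzero only if \<open>T\<close> has the same translations as the lower
  bound, and then it is the sum of \<open>\<mu>(d/d1)\<close>.\<close>

lemma sum_interval_value:
  fixes T :: "('a ^ 2 ^ 2) set" and U :: "'a set"
  assumes T: "subgroup T AGL1" and S1: "fixing_subgroup d1 0 U \<subseteq> T"
    and U: "is_add_subgroup U" "unity_roots d1 \<subseteq> multipliers U"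
    and d1: "d1 dvd CARD('a) - 1"
  shows "(\<Sum>S | subgroup S AGL1 \<and> fixing_subgroup d1 0 U \<subseteq> S \<and> S \<subseteq> T.
            interval_value p d1 U (card (linear_parts S)) (translation_parts S)) =
         (if fixing_subgroup d1 0 U = T then 1 else 0)"
proof -
  let ?S1 = "fixing_subgroup d1 0 U" and ?W = "translation_parts T" and ?D = "card (linear_parts T)"
  let ?I = "{S. subgroup S AGL1 \<and> ?S1 \<subseteq> S \<and> S \<subseteq> T}"
  let ?key = "\<lambda>S :: ('a ^ 2 ^ 2) set. (card (linear_parts S), translation_parts S)"
  let ?orders = "{d. d1 dvd d \<and> d dvd ?D}"
  let ?sub = "\<lambda>d. subspaces_between (unity_roots d) U ?W"
  let ?N = "\<lambda>d H. {S. subgroup S AGL1 \<and> ?S1 \<subseteq> S \<and> S \<subseteq> T \<and>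
                   card (linear_parts S) = d \<and> translation_parts S = H}"
  interpret T: affine_subgroup T by (rule affine_subgroup.intro) fact
  have cd1: "card (unity_roots d1 :: 'a set) = d1" by (rule power_image_unity_roots(2)[OF d1])
  have d10: "d1 > 0" using cd1 unity_roots_one[of d1, where 'a = 'a] by (auto simp: card_gt_0_iff intro!: Nat.gr0I)
  have order_dvd: "card (linear_parts S) dvd card (linear_parts S')"
    if "subgroup S AGL1" "subgroup S' AGL1" "S \<subseteq> S'" for S S' :: "('a ^ 2 ^ 2) set"
    using that by (intro affine_subgroup.card_linear_parts_dvd_mono affine_subgroup.intro)
  have subS1: "subgroup ?S1 AGL1" by (rule fixing_subgroup_subgroup[OF d10 U])
  have linS1: "linear_parts ?S1 = unity_roots d1" by (rule linear_parts_fixing_subgroup[OF U(1)])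
  have UW: "U \<subseteq> ?W" using translation_parts_mono[OF S1] by (simp add: translation_parts_fixing_subgroup)
  have d1D: "d1 dvd ?D" using order_dvd[OF subS1 T S1] linS1 cd1 by simp
  have D0: "?D > 0" using T.mem_one by (auto simp: card_gt_0_iff linear_parts_def)
  have fin: "finite ?orders" using D0 by (auto intro: finite_subset[OF _ finite_divisors_nat])
  have key: "?key ` ?I \<subseteq> Sigma ?orders ?sub"
  proof (intro image_subsetI)
    fix S assume S: "S \<in> ?I"
    interpret S: affine_subgroup S using S by (intro affine_subgroup.intro) simp
    have "d1 dvd card (linear_parts S)" using order_dvd[of ?S1 S] subS1 S linS1 cd1 by simp
    moreover have "card (linear_parts S) dvd ?D" using order_dvd[of S T] S T by simp
    moreover have "U \<subseteq> translation_parts S"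
      using translation_parts_mono[of ?S1 S] S by (simp add: translation_parts_fixing_subgroup)
    moreover have "translation_parts S \<subseteq> ?W" using translation_parts_mono[of S T] S by simp
    moreover have "unity_roots (card (linear_parts S)) \<subseteq> multipliers (translation_parts S)"
      using S.linear_parts_multipliers S.linear_parts_eq by simp
    ultimately show "?key S \<in> Sigma ?orders ?sub"
      using S.translation_parts_add_subgroup by (simp add: subspaces_between_def)
  qed
  have "(\<Sum>S\<in>?I. interval_value p d1 U (card (linear_parts S)) (translation_parts S)) =
      (\<Sum>S\<in>?I. case_prod (interval_value p d1 U) (?key S))"
    by simp
  also have "\<dots> = (\<Sum>x\<in>Sigma ?orders ?sub. \<Sum>S | S \<in> ?I \<and> ?key S = x. case_prod (interval_value p d1 U) (?key S))"
    by (rule sum.group[OF _ _ key, symmetric]) (use fin in \<open>simp_all add: finite_SigmaI\<close>)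
  also have "\<dots> = (\<Sum>(d, H)\<in>Sigma ?orders ?sub. int (card (?N d H)) * interval_value p d1 U d H)"
  proof (rule sum.cong[OF refl])
    fix x :: "nat \<times> 'a set"
    obtain d H where x: "x = (d, H)" by (cases x)
    have "{S. S \<in> ?I \<and> ?key S = (d, H)} = ?N d H" by auto
    moreover have "(\<Sum>S | S \<in> ?I \<and> ?key S = (d, H). case_prod (interval_value p d1 U) (?key S)) =
        (\<Sum>S | S \<in> ?I \<and> ?key S = (d, H). interval_value p d1 U d H)"
      by (rule sum.cong) auto
    ultimately show "(\<Sum>S | S \<in> ?I \<and> ?key S = x. case_prod (interval_value p d1 U) (?key S)) =
        (case x of (d, H) \<Rightarrow> int (card (?N d H)) * interval_value p d1 U d H)"
      unfolding x case_prod_conv by (simp only: sum_constant of_nat_id)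
  qed
  also have "\<dots> = (\<Sum>d\<in>?orders. \<Sum>H\<in>?sub d. int (card (?N d H)) * interval_value p d1 U d H)"
    by (rule sum.Sigma[symmetric]) (use fin in auto)
  also have "\<dots> = (\<Sum>d\<in>?orders. if U = ?W then mobius_nat (d div d1) else 0)"
  proof (rule sum.cong[OF refl])
    fix d assume d: "d \<in> ?orders"
    show "(\<Sum>H\<in>?sub d. int (card (?N d H)) * interval_value p d1 U d H) =
        (if U = ?W then mobius_nat (d div d1) else 0)"
    proof (rule sum_interval_value_fixed_order[OF U(1) T.translation_parts_add_subgroup _ UW])
      show "unity_roots d \<subseteq> multipliers ?W"
        using unity_roots_mono[of d ?D] d T.linear_parts_multipliers T.linear_parts_eq by blast
      show "d dvd CARD('a) - 1" using d T.card_linear_parts_dvd dvd_trans by blast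
      fix H assume "H \<in> ?sub d"
      then show "card (?N d H) * (if d1 = 1 \<and> d \<noteq> 1 then card H else 1) =
          (if d1 = 1 \<and> d \<noteq> 1 then card ?W else 1)"
        by (intro card_subgroups_with_parts[OF T S1 U(1)]) (use d in \<open>auto simp: subspaces_between_def\<close>)
    qed
  qed
  also have "\<dots> = (if U = ?W then if d1 = ?D then 1 else 0 else 0)"
    using sum_mobius_nat_between[OF d1D D0] by simp
  also have "\<dots> = (if ?S1 = T then 1 else 0)"
  proof -
    have "?S1 = T" if "U = ?W" "d1 = ?D"
    proof (rule affine_subgroup.eqI_parts)
      show "linear_parts T \<subseteq> linear_parts ?S1" using linS1 that T.linear_parts_eq by simp
    qed (use that subS1 T S1 in \<open>simp_all add: affine_subgroup_def translation_parts_fixing_subgroup\<close>)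
    moreover have "U = ?W" "d1 = ?D" if "?S1 = T"
      using linS1 cd1 translation_parts_fixing_subgroup[of d1 0 U] unfolding that by simp_all
    ultimately have "?S1 = T \<longleftrightarrow> U = ?W \<and> d1 = ?D" by blast
    then show ?thesis by presburger
  qed
  finally show ?thesis .
qed

lemma mobius_fixing_subgroup:
  fixes U H :: "'a set"
  assumes "is_add_subgroup U" "unity_roots d1 \<subseteq> multipliers U" "is_add_subgroup H" "unity_roots d2 \<subseteq> multipliers H"
    and "U \<subseteq> H" "d1 dvd d2" "d2 dvd CARD('a) - 1"
  shows "mobius (subgroup_lattice AGL1) (fixing_subgroup d1 0 U) (fixing_subgroup d2 0 H) = interval_value p d1 U d2 H"
proof -
  have pos: "d > 0" if "d dvd CARD('a) - 1" for d
    using power_image_unity_roots(2)[OF that] unity_roots_one[of d, where 'a = 'a]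
    by (auto simp: card_gt_0_iff intro!: Nat.gr0I)
  have d1: "d1 dvd CARD('a) - 1" using assms(6,7) by (rule dvd_trans)
  have "mobius (subgroup_lattice AGL1) (fixing_subgroup d1 0 U) (fixing_subgroup d2 0 H) =
    interval_value p d1 U (card (linear_parts (fixing_subgroup d2 0 H))) (translation_parts (fixing_subgroup d2 0 H))"
  proof (rule mobius_subgroup_lattice_eqI[OF is_mobius_function_AGL1])
    show "fixing_subgroup d1 0 U \<subseteq> fixing_subgroup d2 0 H"
      by (rule fixing_subgroup_subset) (use assms in \<open>auto simp: is_add_subgroup_def\<close>)
    show "subgroup (fixing_subgroup d1 0 U) AGL1" "subgroup (fixing_subgroup d2 0 H) AGL1"
      using assms pos d1 by (simp_all add: fixing_subgroup_subgroup)
    show "(\<Sum>S | subgroup S AGL1 \<and> fixing_subgroup d1 0 U \<subseteq> S \<and> S \<subseteq> T.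
            interval_value p d1 U (card (linear_parts S)) (translation_parts S)) =
         (if fixing_subgroup d1 0 U = T then 1 else 0)"
      if "subgroup T AGL1" "fixing_subgroup d1 0 U \<subseteq> T" for T
      using that assms(1,2) d1 by (rule sum_interval_value)
  qed
  then show ?thesis
    using assms by (simp add: linear_parts_fixing_subgroup translation_parts_fixing_subgroup power_image_unity_roots(2))
qed

end

section \<open>Field records, generated subgroups and quotient spaces\<close>

lemma field_rec_simps:
  "carrier \<F> = UNIV" "x \<otimes>\<^bsub>\<F>\<^esub> y = x * y" "x \<oplus>\<^bsub>\<F>\<^esub> y = x + y" "\<one>\<^bsub>\<F>\<^esub> = 1" "\<zero>\<^bsub>\<F>\<^esub> = 0"
  by (simp_all add: ring_of_type_algebra_def)

lemma field_rec_field: "field (\<F> :: 'a::field ring)"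
  by (rule field_from_type_algebra)

lemma field_rec_minus: "\<ominus>\<^bsub>\<F>\<^esub> x = - (x :: 'a::field)"
proof -
  interpret field "\<F> :: 'a ring" by (rule field_rec_field)
  show ?thesis by (rule minus_equality) (simp_all add: field_rec_simps)
qed

lemma field_rec_inverse: "x \<noteq> 0 \<Longrightarrow> inv\<^bsub>\<F>\<^esub> x = inverse (x :: 'a::field)"
proof -
  interpret field "\<F> :: 'a ring" by (rule field_rec_field)
  show "x \<noteq> 0 \<Longrightarrow> inv\<^bsub>\<F>\<^esub> x = inverse x" by (rule comm_inv_char) (simp_all add: field_rec_simps)
qed

lemma subgroup_add_monoid_iff: "subgroup H (add_monoid \<F>) \<longleftrightarrow> is_add_subgroup (H :: 'a::field set)"
proof -
  interpret field "\<F> :: 'a ring" by (rule field_rec_field)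
  have inv: "inv\<^bsub>add_monoid \<F>\<^esub> x = - x" for x :: 'a using field_rec_minus[of x] by (simp add: a_inv_def)
  have mult: "x \<otimes>\<^bsub>add_monoid \<F>\<^esub> y = x + y" for x y :: 'a by (simp add: field_rec_simps)
  show ?thesis
  proof
    assume H: "subgroup H (add_monoid \<F>)"
    have "x - y \<in> H" if "x \<in> H" "y \<in> H" for x y
      using subgroup.m_closed[OF H that(1) subgroup.m_inv_closed[OF H that(2)]] unfolding inv mult by simp
    moreover have "0 \<in> H" using subgroup.one_closed[OF H] by (simp add: field_rec_simps)
    ultimately show "is_add_subgroup H" by (simp add: is_add_subgroup_def)
  next
    assume H: "is_add_subgroup H"
    show "subgroup H (add_monoid \<F>)"
    proof (rule add.subgroupI)
      show "H \<noteq> {}" using is_add_subgroup_zero[OF H] by blast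
    qed (simp_all only: inv mult field_rec_minus field_rec_simps is_add_subgroup_add[OF H] is_add_subgroup_minus[OF H] subset_UNIV)
  qed
qed

lemma subalgebra_iff: "subalgebra K H \<F> \<longleftrightarrow> is_add_subgroup H \<and> K \<subseteq> multipliers (H :: 'a::field set)"
  unfolding subalgebra_def subalgebra_axioms_def subgroup_add_monoid_iff
  by (auto simp: field_rec_simps multipliers_def)

lemma subfield_field_rec_iff: "subfield K \<F> \<longleftrightarrow> is_subfield (K :: 'a::field set)"
proof -
  interpret field "\<F> :: 'a ring" by (rule field_rec_field)
  show ?thesis
  proof
    assume K: "subfield K \<F>"
    note ring = subfieldE(1)[OF K]
    have "inverse x \<in> K" if "x \<in> K" for x
      using subfield_m_inv(1)[OF K, of x] that field_rec_inverse[of x] by (cases "x = 0") (simp_all add: field_rec_simps)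
    then show "is_subfield K"
      using subgroup_add_monoid_iff[THEN iffD1, OF subring.axioms(1)[OF ring]] subringE(3,6)[OF ring]
      by (auto simp: is_subfield_def field_rec_simps)
  next
    assume K: "is_subfield K"
    then have H: "is_add_subgroup K" by (simp add: is_subfield_def)
    show "subfield K \<F>"
    proof (rule subfieldI')
      show "subring K \<F>"
        by (rule subringI) (use K is_add_subgroup_minus[OF H] is_add_subgroup_add[OF H] in
          \<open>auto simp: is_subfield_def field_rec_simps field_rec_minus\<close>)
      show "inv\<^bsub>\<F>\<^esub> k \<in> K" if "k \<in> K - {\<zero>\<^bsub>\<F>\<^esub>}" for k
        using that K by (simp add: field_rec_simps field_rec_inverse is_subfield_def)
    qed
  qed
qed

text \<open>With the subfield of multipliers of an additive subgroup for \<open>L\<close>, closure under the field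
  generated by \<open>a\<close> becomes closure under \<open>a\<close> alone.\<close>

lemma generate_field_subset_iff:
  assumes "is_subfield (L :: 'a::field set)"
  shows "generate_field \<F> {a} \<subseteq> L \<longleftrightarrow> a \<in> L"
proof -
  interpret field "\<F> :: 'a ring" by (rule field_rec_field)
  show ?thesis
    using generate_field_min_subfield1[of "{a}" L] assms generate_field.incl[of a "{a}" \<F>]
    by (auto simp: subfield_field_rec_iff field_rec_simps)
qed

lemma (in finite_field_order) subfield_of_order_p_of:
  assumes d: "d dvd CARD('a) - 1"
  shows "(subfield_of_order (p_of p d) :: 'a set) = frobenius_fixed (p_of p d)"
  unfolding subfield_of_order_def
proof (rule the_equality)
  show "subfield (frobenius_fixed (p_of p d) :: 'a set) \<F> \<and> card (frobenius_fixed (p_of p d) :: 'a set) = p_of p d"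
    using root_field_subfield[OF d] card_root_field[OF d] by (simp add: subfield_field_rec_iff)
  show "L = frobenius_fixed (p_of p d)" if "subfield L \<F> \<and> card L = p_of p d" for L :: "'a set"
    by (rule subfield_eq_root_field[OF d]) (use that in \<open>simp_all add: subfield_field_rec_iff\<close>)
qed

text \<open>The \<open>d\<close>-th roots of unity are all of the form \<open>x\<^sup>m\<close> with \<open>m = (q-1)/d\<close>; it suffices to insert the
  powers of \<open>\<gamma>\<close> for \<open>x\<close>.\<close>

lemma unity_roots_powers:
  fixes \<gamma> :: "'a::{field,finite}"
  assumes gen: "generate (Multiplicative_Group.mult_of \<F>) {\<gamma>} = carrier (Multiplicative_Group.mult_of \<F>)"
    and d: "d dvd CARD('a) - 1"
  shows "unity_roots d = range (\<lambda>i. (\<gamma> ^ ((CARD('a) - 1) div d)) ^ i)"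
proof -
  interpret field "\<F> :: 'a ring" by (rule field_rec_field)
  have carr: "carrier (Multiplicative_Group.mult_of \<F>) = - {0 :: 'a}" by (auto simp: field_rec_simps)
  have "\<gamma> \<in> generate (Multiplicative_Group.mult_of \<F>) {\<gamma>}" by (rule generate.incl) simp
  then have g0: "\<gamma> \<noteq> 0" unfolding gen carr by simp
  have pow: "x ^ (CARD('a) - 1) = 1" if "x \<noteq> 0" for x :: 'a
    using mult_closed_power_card[of "- {0 :: 'a}" x] that by (simp add: Compl_eq_Diff_UNIV)
  have cyc: "x \<in> range (\<lambda>i. \<gamma> ^ i)" if "x \<in> generate (Multiplicative_Group.mult_of \<F>) {\<gamma>}" for x
    using that
  proof (induction rule: generate.induct)
    case one
    show ?case by (auto simp: field_rec_simps intro: image_eqI[of _ _ 0])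
  next
    case (incl h)
    then show ?case by (auto intro: image_eqI[of _ _ 1])
  next
    case (inv h)
    have "card {0, 1 :: 'a} \<le> CARD('a)" by (rule card_mono) auto
    then have "CARD('a) - 1 = Suc (CARD('a) - 2)" by simp
    then have "\<gamma> * \<gamma> ^ (CARD('a) - 2) = 1" using pow[OF g0] by simp
    then have "inverse \<gamma> = \<gamma> ^ (CARD('a) - 2)" by (rule inverse_unique)
    moreover have "inv\<^bsub>Multiplicative_Group.mult_of \<F>\<^esub> \<gamma> = inverse \<gamma>"
      using m_inv_mult_of[of \<gamma>] g0 by (simp add: field_rec_inverse field_rec_simps)
    ultimately show ?case using inv by auto
  next
    case (eng h1 h2)
    then obtain i j where "h1 = \<gamma> ^ i" "h2 = \<gamma> ^ j" by blast
    then show ?case by (auto simp: field_rec_simps power_add[symmetric])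
  qed
  have "range (\<lambda>i. \<gamma> ^ i) = - {0}" using cyc g0 unfolding gen carr by auto
  then have "unity_roots d = (\<lambda>x. x ^ ((CARD('a) - 1) div d)) ` range (\<lambda>i. \<gamma> ^ i)"
    using power_image_unity_roots(1)[OF d] by simp
  then show ?thesis by (simp add: image_image mult.commute flip: power_mult)
qed

lemma S_subgroup_eq_fixing_subgroup:
  fixes H :: "'a::{field,finite} set"
  assumes d: "d > 0" and H: "is_add_subgroup H" "unity_roots d \<subseteq> multipliers H"
    and a: "unity_roots d = range (\<lambda>i. a ^ i)"
  shows "S_subgroup a H = fixing_subgroup d 0 H"
  unfolding S_subgroup_def
proof (rule group.generateI[OF group_AGL1, symmetric])
  show "subgroup (fixing_subgroup d 0 H) AGL1" by (rule fixing_subgroup_subgroup[OF d H])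
  have "a \<in> unity_roots d" unfolding a by (rule range_eqI[of _ _ 1]) simp
  then show "{affine_mat a 0} \<union> affine_mat 1 ` H \<subseteq> fixing_subgroup d 0 H"
    using is_add_subgroup_zero[OF H(1)] by (auto simp: affine_mat_in_fixing_subgroup unity_roots_one)
next
  fix K assume K: "subgroup K AGL1" "{affine_mat a 0} \<union> affine_mat 1 ` H \<subseteq> K"
  interpret K: affine_subgroup K by (rule affine_subgroup.intro) fact
  have pow: "affine_mat (a ^ i) 0 \<in> K" for i
  proof (induction i)
    case 0
    show ?case using K.mem_one by simp
  next
    case (Suc i)
    have "affine_mat a 0 \<in> K" using K(2) by simp
    from K.mem_mult[OF this Suc] show ?case by simp
  qed
  show "fixing_subgroup d 0 H \<subseteq> K"
  proof
    fix A assume "A \<in> fixing_subgroup d 0 H"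
    then obtain i y where A: "A = affine_mat (a ^ i) y" "y \<in> H" by (auto simp: fixing_subgroup_def a)
    have "affine_mat 1 y \<in> K" using A K(2) by auto
    from K.mem_mult[OF this pow[of i]] show "A \<in> K" using A by simp
  qed
qed

text \<open>Coordinates with respect to a basis \<open>B\<close> identify the space with the functions from \<open>B\<close> to the
  scalars.\<close>

lemma (in vectorspace) card_carrier_eq_power_dim:
  assumes fin: "finite (carrier V)"
  shows "card (carrier V) = card (carrier K) ^ dim"
proof -
  have "carrier V \<subseteq> span (carrier V)" by (rule in_own_span) simp
  moreover have "span (carrier V) \<subseteq> carrier V" by (rule span_is_subset2) simp
  ultimately have "gen_set (carrier V)" by blast
  then have "fin_dim" unfolding fin_dim_def using fin by blast
  then obtain B where B: "finite B" "basis B" using finite_basis_exists by blast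
  then have Bc: "B \<subseteq> carrier V" by (simp add: basis_def)
  have "\<forall>v. v \<in> carrier V \<longrightarrow> (\<exists>!a. a \<in> B \<rightarrow>\<^sub>E carrier K \<and> lincomb a B = v)"
    using basis_criterion[OF B(1) Bc] B(2) by blast
  moreover have "lincomb a B \<in> carrier V" if "a \<in> B \<rightarrow>\<^sub>E carrier K" for a
    using that Bc by (intro lincomb_closed) auto
  ultimately have "bij_betw (\<lambda>a. lincomb a B) (B \<rightarrow>\<^sub>E carrier K) (carrier V)"
    unfolding bij_betw_def inj_on_def by (intro conjI ballI impI equalityI subsetI) (blast, blast, blast)
  then have "card (B \<rightarrow>\<^sub>E carrier K) = card (carrier V)" by (rule bij_betw_same_card)
  then show ?thesis using card_funcsetE[OF B(1), of "carrier K"] dim_basis[OF B] by simp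
qed

context
  fixes K U W :: "'a::{field,finite} set"
  assumes K: "is_subfield K"
    and U: "is_add_subgroup U" "K \<subseteq> multipliers U" and W: "is_add_subgroup W" "K \<subseteq> multipliers W"
    and UW: "U \<subseteq> W"
begin

lemma quotient_space_carrier: "carrier (quotient_space \<F> W U) = (\<lambda>x. (+) x ` U) ` W"
  by (auto simp: quotient_space_def A_RCOSETS_def RCOSETS_def r_coset_def field_rec_simps add.commute)

lemma coset_add: "(+) x ` U \<oplus>\<^bsub>quotient_space \<F> W U\<^esub> (+) y ` U = (+) (x + y) ` U"
proof -
  have "\<exists>u\<in>U. x + u1 + (y + u2) = x + y + u" if "u1 \<in> U" "u2 \<in> U" for u1 u2
    using that by (intro bexI[of _ "u1 + u2"]) (simp_all add: is_add_subgroup_add[OF U(1)] add_ac)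
  moreover have "\<exists>u1\<in>U. \<exists>u2\<in>U. x + y + u = x + u1 + (y + u2)" if "u \<in> U" for u
    using that is_add_subgroup_zero[OF U(1)] by (intro bexI[of _ u] bexI[of _ 0]) (simp_all add: add_ac)
  ultimately show ?thesis
    by (auto simp: quotient_space_def set_add_def set_mult_def field_rec_simps image_iff)
qed

lemma coset_smult:
  assumes "k \<in> K"
  shows "k \<odot>\<^bsub>quotient_space \<F> W U\<^esub> (+) x ` U = (+) (k * x) ` U"
proof -
  have "\<exists>u\<in>U. k * (x + u1) + u2 = k * x + u" if "u1 \<in> U" "u2 \<in> U" for u1 u2
    using that assms U(2) by (intro bexI[of _ "k * u1 + u2"])
      (auto simp: algebra_simps intro!: is_add_subgroup_add[OF U(1)] multipliersD)
  moreover have "\<exists>u1\<in>U. \<exists>u2\<in>U. k * x + u = k * (x + u1) + u2" if "u \<in> U" for u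
    using that is_add_subgroup_zero[OF U(1)] by (intro bexI[of _ 0] bexI[of _ u]) simp_all
  ultimately show ?thesis
    by (auto simp: quotient_space_def set_add_def set_mult_def field_rec_simps image_iff)
qed

lemma quotient_space_vectorspace: "vectorspace (\<F>\<lparr>carrier := K\<rparr>) (quotient_space \<F> W U)"
proof (rule vs_criteria)
  interpret field "\<F> :: 'a ring" by (rule field_rec_field)
  show "field (\<F>\<lparr>carrier := K\<rparr>)" using subfield_iff(2) K subfield_field_rec_iff by blast
  define C where "C x = (+) x ` U" for x
  let ?Q = "quotient_space \<F> W U"
  have carr: "carrier ?Q = C ` W" using quotient_space_carrier by (simp add: C_def)
  have add: "C x \<oplus>\<^bsub>?Q\<^esub> C y = C (x + y)" for x y using coset_add by (simp add: C_def)
  have smult: "k \<odot>\<^bsub>?Q\<^esub> C x = C (k * x)" if "k \<in> K" for k x using coset_smult[OF that] by (simp add: C_def)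
  have zero: "\<zero>\<^bsub>?Q\<^esub> = C 0" by (simp add: quotient_space_def C_def)
  note simps = carr add zero field_rec_simps
  have KW: "k * x \<in> W" if "k \<in> K" "x \<in> W" for k x using that W(2) by (auto intro: multipliersD)
  have Kcl: "a * b \<in> K" "a + b \<in> K" if "a \<in> K" "b \<in> K" for a b
    using that K by (simp_all add: is_subfield_def is_add_subgroup_add)
  show "\<zero>\<^bsub>?Q\<^esub> \<in> carrier ?Q"
    unfolding simps using is_add_subgroup_zero[OF W(1)] by blast
  show "\<forall>v w. v \<in> carrier ?Q \<and> w \<in> carrier ?Q \<longrightarrow> v \<oplus>\<^bsub>?Q\<^esub> w \<in> carrier ?Q"
    by (auto simp: simps is_add_subgroup_add[OF W(1)])
  show "\<forall>v\<in>carrier ?Q. \<exists>neg_v\<in>carrier ?Q. v \<oplus>\<^bsub>?Q\<^esub> neg_v = \<zero>\<^bsub>?Q\<^esub>"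
  proof
    fix v assume "v \<in> carrier ?Q"
    then obtain x where x: "x \<in> W" "v = C x" unfolding simps by blast
    then show "\<exists>neg_v\<in>carrier ?Q. v \<oplus>\<^bsub>?Q\<^esub> neg_v = \<zero>\<^bsub>?Q\<^esub>"
      using is_add_subgroup_minus[OF W(1)] by (intro bexI[of _ "C (- x)"]) (auto simp: simps)
  qed
  show "\<forall>c v. c \<in> carrier (\<F>\<lparr>carrier := K\<rparr>) \<and> v \<in> carrier ?Q \<longrightarrow> c \<odot>\<^bsub>?Q\<^esub> v \<in> carrier ?Q"
    by (auto simp: simps smult KW)
  show "\<forall>v w. v \<in> carrier ?Q \<and> w \<in> carrier ?Q \<longrightarrow> v \<oplus>\<^bsub>?Q\<^esub> w = w \<oplus>\<^bsub>?Q\<^esub> v"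
    by (auto simp: simps add.commute)
  show "\<forall>v w x. v \<in> carrier ?Q \<and> w \<in> carrier ?Q \<and> x \<in> carrier ?Q \<longrightarrow>
      v \<oplus>\<^bsub>?Q\<^esub> w \<oplus>\<^bsub>?Q\<^esub> x = v \<oplus>\<^bsub>?Q\<^esub> (w \<oplus>\<^bsub>?Q\<^esub> x)"
    by (auto simp: simps add.assoc)
  show "\<forall>v\<in>carrier ?Q. v \<oplus>\<^bsub>?Q\<^esub> \<zero>\<^bsub>?Q\<^esub> = v"
    by (auto simp: simps)
  show "\<forall>a b v. a \<in> carrier (\<F>\<lparr>carrier := K\<rparr>) \<and> b \<in> carrier (\<F>\<lparr>carrier := K\<rparr>) \<and> v \<in> carrier ?Q \<longrightarrow>
      a \<otimes>\<^bsub>\<F>\<lparr>carrier := K\<rparr>\<^esub> b \<odot>\<^bsub>?Q\<^esub> v = a \<odot>\<^bsub>?Q\<^esub> (b \<odot>\<^bsub>?Q\<^esub> v)"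
    by (auto simp: simps smult Kcl mult.assoc)
  show "\<forall>v\<in>carrier ?Q. \<one>\<^bsub>\<F>\<lparr>carrier := K\<rparr>\<^esub> \<odot>\<^bsub>?Q\<^esub> v = v"
    using K by (auto simp: simps smult is_subfield_def)
  show "\<forall>a b v. a \<in> carrier (\<F>\<lparr>carrier := K\<rparr>) \<and> b \<in> carrier (\<F>\<lparr>carrier := K\<rparr>) \<and> v \<in> carrier ?Q \<longrightarrow>
      (a \<oplus>\<^bsub>\<F>\<lparr>carrier := K\<rparr>\<^esub> b) \<odot>\<^bsub>?Q\<^esub> v = a \<odot>\<^bsub>?Q\<^esub> v \<oplus>\<^bsub>?Q\<^esub> b \<odot>\<^bsub>?Q\<^esub> v"
    by (auto simp: simps smult Kcl distrib_right)
  show "\<forall>a v w. a \<in> carrier (\<F>\<lparr>carrier := K\<rparr>) \<and> v \<in> carrier ?Q \<and> w \<in> carrier ?Q \<longrightarrow>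
      a \<odot>\<^bsub>?Q\<^esub> (v \<oplus>\<^bsub>?Q\<^esub> w) = a \<odot>\<^bsub>?Q\<^esub> v \<oplus>\<^bsub>?Q\<^esub> a \<odot>\<^bsub>?Q\<^esub> w"
    by (auto simp: simps smult distrib_left)
qed

lemma card_quotient_space: "card W = card (carrier (quotient_space \<F> W U)) * card U"
proof -
  have "card W = (\<Sum>C\<in>(\<lambda>x. (+) x ` U) ` W. card {x \<in> W. (+) x ` U = C})"
    using sum.image_gen[of W "\<lambda>_. 1 :: nat" "\<lambda>x. (+) x ` U"] by simp
  also have "\<dots> = (\<Sum>C\<in>(\<lambda>x. (+) x ` U) ` W. card U)"
  proof (rule sum.cong[OF refl], clarify)
    fix y assume y: "y \<in> W"
    have "(+) x ` U = (+) y ` U \<longleftrightarrow> x - y \<in> U" for x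
    proof
      assume "(+) x ` U = (+) y ` U"
      moreover have "x \<in> (+) x ` U" using is_add_subgroup_zero[OF U(1)] by (auto simp: image_iff)
      ultimately show "x - y \<in> U" by auto
    next
      assume xy: "x - y \<in> U"
      have "x + u \<in> (+) y ` U" if "u \<in> U" for u
        using that xy by (intro image_eqI[of _ _ "x - y + u"]) (simp_all add: is_add_subgroup_add[OF U(1)])
      moreover have "y + u \<in> (+) x ` U" if "u \<in> U" for u
        using that xy by (intro image_eqI[of _ _ "u - (x - y)"]) (simp_all add: is_add_subgroup_diff[OF U(1)])
      ultimately show "(+) x ` U = (+) y ` U" by blast
    qed
    moreover have "x \<in> W" if "x - y \<in> U" for x
      using is_add_subgroup_add[OF W(1), of "x - y" y] that UW y by auto
    ultimately have "{x \<in> W. (+) x ` U = (+) y ` U} = {x. x - y \<in> U}" by blast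
    then show "card {x \<in> W. (+) x ` U = (+) y ` U} = card U" by (simp add: card_translate)
  qed
  finally show ?thesis by (simp add: quotient_space_carrier)
qed

text \<open>The order of a finite vector space determines its dimension, so the dimension of the quotient
  space can be read off from the orders of \<open>W\<close> and \<open>U\<close>.\<close>

lemma mobius_space_quotient_space:
  "mobius_space (\<F>\<lparr>carrier := K\<rparr>) (quotient_space \<F> W U) = subspace_mobius (card K) U W"
proof -
  let ?l = "vectorspace.dim (\<F>\<lparr>carrier := K\<rparr>) (quotient_space \<F> W U)"
  have "card (carrier (quotient_space \<F> W U)) = card K ^ ?l"
    using vectorspace.card_carrier_eq_power_dim[OF quotient_space_vectorspace]
    by (simp add: quotient_space_carrier)
  then have "card W = card K ^ ?l * card U" using card_quotient_space by simp
  moreover have "card U > 0" using U(1) by (auto simp: card_gt_0_iff is_add_subgroup_def)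
  ultimately have "subspace_mobius (card K) U W = (-1) ^ ?l * int (card K) ^ (?l choose 2)"
    by (intro subspace_mobius_eq[OF card_subfield_gt_1[OF K]])
  then show ?thesis by (simp add: mobius_space_def order_def Let_def)
qed

end

theorem theorem4p1:
  fixes p n q d1 d2 :: nat and \<gamma> :: "'a::{field, finite}" and H1 H2 :: "'a set"
    and S1 S2 :: "('a ^ 2 ^ 2) set"
  assumes "Factorial_Ring.prime p" and "n \<ge> 1" and "q = p ^ n" and "CARD('a) = q"
    and "\<gamma> \<in> carrier (Multiplicative_Group.mult_of \<F>)"
    and "generate (Multiplicative_Group.mult_of \<F>) {\<gamma>} = carrier (Multiplicative_Group.mult_of \<F>)"
    and "d1 > 0" and "d2 > 0" and "d1 dvd d2" and "d2 dvd q - 1"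
    and "subalgebra (generate_field \<F> {\<gamma> ^ ((q - 1) div d1)}) H1 \<F>"
    and "subalgebra (generate_field \<F> {\<gamma> ^ ((q - 1) div d2)}) H2 \<F>"
    and "H1 \<subseteq> H2"
    and "S1 = S_subgroup (\<gamma> ^ ((q - 1) div d1)) H1"
    and "S2 = S_subgroup (\<gamma> ^ ((q - 1) div d2)) H2"
  shows "(\<not> subalgebra (subfield_of_order (p_of p d2)) H1 \<F> \<longrightarrow>
            mobius (subgroup_lattice AGL1) S1 S2 = 0) \<and>
         (subalgebra (subfield_of_order (p_of p d2)) H1 \<F> \<longrightarrow>
            mobius (subgroup_lattice AGL1) S1 S2 =
              (let \<mu>V = mobius_space (\<F>\<lparr>carrier := subfield_of_order (p_of p d2)\<rparr>)
                          (quotient_space \<F> H2 H1)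
               in if d1 \<noteq> 1 then mobius_nat (d2 div d1) * \<mu>V
                  else if d2 \<noteq> 1 then int (card H2 div card H1) * mobius_nat d2 * \<mu>V
                  else \<mu>V))"
proof -
  interpret finite_field_order "TYPE('a)" p n by (rule finite_field_order.intro) (use assms(1-4) in simp_all)
  have q: "CARD('a) - 1 = q - 1" using assms(4) by simp
  have d2: "d2 dvd CARD('a) - 1" using assms(10) q by simp
  have d1: "d1 dvd CARD('a) - 1" using assms(9) d2 by (rule dvd_trans)
  note pow = unity_roots_powers[OF assms(6), unfolded q]
  have roots: "unity_roots d \<subseteq> multipliers H"
    if d: "d dvd CARD('a) - 1" and H: "subalgebra (generate_field \<F> {\<gamma> ^ ((q - 1) div d)}) H \<F>" for d and H :: "'a set"
  proof -
    have sf: "is_subfield (multipliers H)" using H by (simp add: subalgebra_iff multipliers_subfield)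
    then have a: "\<gamma> ^ ((q - 1) div d) \<in> multipliers H"
      using H by (simp add: subalgebra_iff generate_field_subset_iff)
    have "(\<gamma> ^ ((q - 1) div d)) ^ i \<in> multipliers H" for i
      by (induction i) (use sf a in \<open>auto simp: is_subfield_def\<close>)
    then show ?thesis using pow[of d] d q by auto
  qed
  note R1 = roots[OF d1 assms(11)] and R2 = roots[OF d2 assms(12)]
  have H1: "is_add_subgroup H1" and H2: "is_add_subgroup H2" using assms(11,12) by (simp_all add: subalgebra_iff)
  have "S1 = fixing_subgroup d1 0 H1" "S2 = fixing_subgroup d2 0 H2"
    unfolding assms(14,15) using assms(7,8) H1 H2 R1 R2 pow d1 d2 q by (simp_all add: S_subgroup_eq_fixing_subgroup)
  then have mob: "mobius (subgroup_lattice AGL1) S1 S2 = interval_value p d1 H1 d2 H2"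
    using mobius_fixing_subgroup[OF H1 R1 H2 R2 assms(13,9) d2] by simp
  let ?K = "frobenius_fixed (p_of p d2) :: 'a set"
  have K: "subfield_of_order (p_of p d2) = ?K" by (rule subfield_of_order_p_of[OF d2])
  note rf = root_field_multipliers_iff[OF d2]
  have iff: "subalgebra ?K H1 \<F> \<longleftrightarrow> unity_roots d2 \<subseteq> multipliers H1"
    using rf[OF H1] H1 by (simp add: subalgebra_iff)
  have space: "mobius_space (\<F>\<lparr>carrier := ?K\<rparr>) (quotient_space \<F> H2 H1) = subspace_mobius (p_of p d2) H1 H2"
    if "unity_roots d2 \<subseteq> multipliers H1"
    using mobius_space_quotient_space[OF root_field_subfield[OF d2] H1 _ H2 _ assms(13)] rf[OF H1] rf[OF H2] that R2
    by (simp add: card_root_field[OF d2])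
  \<comment> \<open>For \<open>d1 = d2 = 1\<close> the arithmetic factor is \<open>\<mu>(1)\<close>, which the claim omits.\<close>
  have one: "mobius_nat 1 = 1" by (simp add: mobius_nat_def)
  show ?thesis
    unfolding K mob iff interval_value_def Let_def using space one by auto
qed

end
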